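(* Let $\Phi=\{\phi_a(x)=\frac{x+\mathfrak{p}_a}{q_a}\}_{a\in\mathcal{A}}$ be an IFS on $\mathbb{R}^d$ with $\mathfrak{p}_a\in\mathbb{Z}^d$, $q_a\in\mathbb{Z}$, $|q_a|\ge2$, and let $g:\mathbb{N}\to[0,\infty)$. Then: \begin{enumerate} \item For any $s\ge0$, if $\sum_{n=1}^\infty\sum_{\mathbf{a}\in\mathcal{A}^n}n\cdot(\mathrm{Diam}(X_{\mathbf{a}})g(n))^s<\infty$, then $\mathcal{H}^s(W^{**}_\Phi(g))=0$. \item If $g$ is non-increasing, $h_{\mathbf{p}}<-2\log\sum_{a\in\mathcal{A}}p_a^2$, and $\sum_{n=1}^\infty\sum_{\mathbf{a}\in\mathcal{A}^n}n\cdot(\mathrm{Diam}(X_{\mathbf{a}})g(n))^{\dim_S(\Phi)}=\infty$, then $\mu(W^{**}_\Phi(g))=1$. \end{enumerate}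
   Context: $X$ is the self-similar set of $\Phi$ (unique non-empty compact set with $X=\bigcup_a\phi_a(X)$), $\pi:\mathcal{A}^{\mathbb{N}}\to X$, $\pi((a_n))=\sum_{n\ge1}\mathfrak{p}_{a_n}/\prod_{l=1}^n q_{a_l}$. For a finite word $\mathbf{a}=a_1\cdots a_n$: $|\mathbf{a}|=n$, $\phi_{\mathbf{a}}=\phi_{a_1}\circ\cdots\circ\phi_{a_n}$, $X_{\mathbf{a}}=\phi_{\mathbf{a}}(X)$; $\mathbf{b}^\infty$ is the infinite periodic concatenation. Contraction ratios are $r_a=1/|q_a|$; $\dim_S(\Phi)$ is the unique $s$ with $\sum_a r_a^s=1$; $\mathbf{p}=(p_a)$ with $p_a=r_a^{\dim_S(\Phi)}$; $h_{\mathbf{p}}=-\sum_a p_a\log p_a$; $\mu=\pi_*\mathfrak{m}$ with $\mathfrak{m}$ the Bernoulli measure with marginal $\mathbf{p}$. For $\mathfrak{p}/q\in X\cap\mathbb{Q}^d$ let $\Psi_g(\mathfrak{p}/q)=\max\{\mathrm{Diam}(X_{\mathbf{a}})g(|\mathbf{a}|):\mathbf{a}\in\bigcup_n\mathcal{A}^n,\ 0\le l\le|\mathbf{a}|-1,\ \mathfrak{p}/q=\pi(a_1\cdots a_l(a_{l+1}\cdots a_{|\mathbf{a}|})^\infty)\}$, and $W^{**}_\Phi(g)=\{x\in X:\|x-\mathfrak{p}/q\|<\Psi_g(\mathfrak{p}/q)\text{ for infinitely many }\mathfrak{p}/q\in X\cap\mathbb{Q}^d\}$. *)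

theory Defs
  imports "HOL-Probability.Probability"
begin

text \<open>
  An IFS \<open>\<phi>\<^sub>a(x) = (x + P a) / q a\<close> is represented by its data \<open>P\<close> and \<open>q\<close> over a finite
  alphabet type. Finite words are lists and infinite words are streams; letters are
  counted from \<open>0\<close>, so the letter \<open>a\<^sub>n\<close> (\<open>n \<ge> 1\<close>) of \<open>a\<^sub>1 a\<^sub>2 \<dots>\<close> has index \<open>n - 1\<close>.
\<close>

definition int_vec :: "int ^ 'd \<Rightarrow> real ^ 'd"
  where "int_vec v = (\<chi> i. real_of_int (v $ i))"

definition ifs_map :: "('a \<Rightarrow> int ^ 'd) \<Rightarrow> ('a \<Rightarrow> int) \<Rightarrow> 'a \<Rightarrow> real ^ 'd \<Rightarrow> real ^ 'd"
  where "ifs_map P q a x = (1 / real_of_int (q a)) *\<^sub>R (x + int_vec (P a))"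

definition self_similar_set :: "('a::finite \<Rightarrow> int ^ 'd) \<Rightarrow> ('a \<Rightarrow> int) \<Rightarrow> (real ^ 'd) set"
  where "self_similar_set P q =
    (THE K. K \<noteq> {} \<and> compact K \<and> K = (\<Union>a. ifs_map P q a ` K))"

definition cylinder :: "('a::finite \<Rightarrow> int ^ 'd) \<Rightarrow> ('a \<Rightarrow> int) \<Rightarrow> 'a list \<Rightarrow> (real ^ 'd) set"
  where "cylinder P q w = foldr (ifs_map P q) w ` self_similar_set P q"

definition coding_map :: "('a \<Rightarrow> int ^ 'd) \<Rightarrow> ('a \<Rightarrow> int) \<Rightarrow> 'a stream \<Rightarrow> real ^ 'd"
  where "coding_map P q \<omega> =
    (\<Sum>n. (1 / real_of_int (\<Prod>l\<le>n. q (\<omega> !! l))) *\<^sub>R int_vec (P (\<omega> !! n)))"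

definition contr_ratio :: "('a \<Rightarrow> int) \<Rightarrow> 'a \<Rightarrow> real"
  where "contr_ratio q a = 1 / real_of_int \<bar>q a\<bar>"

definition sim_dim :: "('a::finite \<Rightarrow> int) \<Rightarrow> real"
  where "sim_dim q = (THE s. (\<Sum>a\<in>UNIV. contr_ratio q a powr s) = 1)"

definition prob_weight :: "('a::finite \<Rightarrow> int) \<Rightarrow> 'a \<Rightarrow> real"
  where "prob_weight q a = contr_ratio q a powr sim_dim q"

definition weight_entropy :: "('a::finite \<Rightarrow> int) \<Rightarrow> real"
  where "weight_entropy q = - (\<Sum>a\<in>UNIV. prob_weight q a * ln (prob_weight q a))"

definition bernoulli_measure :: "('a::finite \<Rightarrow> int) \<Rightarrow> 'a stream measure"
  where "bernoulli_measure q =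
    stream_space (point_measure UNIV (\<lambda>a. ennreal (prob_weight q a)))"

definition self_similar_measure ::
    "('a::finite \<Rightarrow> int ^ 'd) \<Rightarrow> ('a \<Rightarrow> int) \<Rightarrow> (real ^ 'd) measure"
  where "self_similar_measure P q = distr (bernoulli_measure q) borel (coding_map P q)"

definition rational_points :: "(real ^ 'd) set"
  where "rational_points = {x. \<forall>i. x $ i \<in> \<rat>}"

text \<open>
  The maximum over all eventually periodic codings is taken as a supremum in
  \<open>ennreal\<close>: it is the maximum whenever that exists, and it is \<open>\<infinity>\<close> if the set of
  values is unbounded (possible only for rapidly growing \<open>g\<close>).
\<close>

definition Psi ::
    "('a::finite \<Rightarrow> int ^ 'd) \<Rightarrow> ('a \<Rightarrow> int) \<Rightarrow> (nat \<Rightarrow> real) \<Rightarrow> real ^ 'd \<Rightarrow> ennreal"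
  where "Psi P q g r =
    (SUP (w, l) \<in> {(w, l). l < length w \<and> r = coding_map P q (take l w @- cycle (drop l w))}.
       ennreal (diameter (cylinder P q w) * g (length w)))"

definition well_approx_set ::
    "('a::finite \<Rightarrow> int ^ 'd) \<Rightarrow> ('a \<Rightarrow> int) \<Rightarrow> (nat \<Rightarrow> real) \<Rightarrow> (real ^ 'd) set"
  where "well_approx_set P q g = {x \<in> self_similar_set P q.
    infinite {r \<in> self_similar_set P q \<inter> rational_points. ennreal (norm (x - r)) < Psi P q g r}}"

text \<open>
  In the volume series the index \<open>n\<close> below stands for word length \<open>n + 1\<close>.
  Note that \<open>0 powr 0 = 0\<close>; this only matters for \<open>s = 0\<close>.
\<close>

definition volume_series ::
    "('a::finite \<Rightarrow> int ^ 'd) \<Rightarrow> ('a \<Rightarrow> int) \<Rightarrow> (nat \<Rightarrow> real) \<Rightarrow> real \<Rightarrow> ennreal"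
  where "volume_series P q g s =
    (\<Sum>n. \<Sum>w | length w = Suc n.
       ennreal (real (Suc n) * (diameter (cylinder P q w) * g (Suc n)) powr s))"

text \<open>
  Hausdorff (outer) measure. The gauge \<open>diam(U)\<^sup>s\<close> uses the usual conventions for \<open>s = 0\<close>,
  namely \<open>1\<close> for nonempty \<open>U\<close> (so that the result is counting measure) and \<open>0\<close> for
  the empty set; it coincides with \<open>diameter U powr s\<close> when \<open>s > 0\<close>. Boundedness of the
  covering sets is required explicitly because \<open>diameter\<close> is meaningless on unbounded sets.
\<close>

definition hausdorff_gauge :: "real \<Rightarrow> 'b::metric_space set \<Rightarrow> ennreal"
  where "hausdorff_gauge s U =
    (if U = {} then 0 else if s = 0 then 1 else ennreal (diameter U powr s))"

definition hausdorff_premeasure :: "real \<Rightarrow> real \<Rightarrow> 'b::metric_space set \<Rightarrow> ennreal"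
  where "hausdorff_premeasure s \<delta> E =
    (INF U \<in> {U :: nat \<Rightarrow> 'b set. E \<subseteq> (\<Union>i. U i) \<and> (\<forall>i. bounded (U i) \<and> diameter (U i) \<le> \<delta>)}.
       \<Sum>i. hausdorff_gauge s (U i))"

definition hausdorff_measure :: "real \<Rightarrow> 'b::metric_space set \<Rightarrow> ennreal"
  where "hausdorff_measure s E = (SUP \<delta> \<in> {0<..}. hausdorff_premeasure s \<delta> E)"

end

theory Submission
  imports Defs "HOL-Library.Sublist"
begin

text \<open>
  The convergence part is the covering by the balls around the eventually periodic points: only
  long words contribute to a point with infinitely many approximations.

  For the divergence part let \<open>\<omega>\<close> be a random sequence. If a word \<open>u\<close> occurs in \<open>\<omega>\<close> at positions
  \<open>l\<close> and \<open>N \<ge> l + |u|\<close>, then the sequence that repeats \<open>\<omega>\<^sub>l \<dots> \<omega>\<^bsub>N-1\<^esub>\<close> after \<open>\<omega>\<^sub>0 \<dots> \<omega>\<^bsub>l-1\<^esub>\<close> agrees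
  with \<open>\<omega>\<close> up to position \<open>N + |u|\<close>, so its image approximates that of \<open>\<omega>\<close> well enough as soon as
  the contraction ratio of \<open>u\<close> is below \<open>g N\<close>. Comparing words cut at a fixed weight \<open>t\<close>, rather than at a fixed
  length, makes every coincidence have probability comparable to \<open>t\<close>. Among \<open>M\<^sup>2\<close> pairs of
  positions in the block \<open>[4M, 8M)\<close>, \<open>M = 2^k\<close>, the second moment method gives a coincidence with
  probability at least \<open>c M\<^sup>2 t\<close>: pairs that are far apart are independent, overlapping pairs on a
  common diagonal decay geometrically, and overlapping pairs on different diagonals force a long
  self-repetition. Distinct blocks are independent, so the second Borel-Cantelli lemma applies.
  The approximating points are infinitely many because the measure has no atoms, hence does not
  charge the rational points.
\<close>

subsection \<open>Series and thresholds\<close>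

text \<open>With \<open>\<rho>\<close> and \<open>a\<close> the largest and smallest letter weights,
  \<open>R\<close> and \<open>m\<close> will bound the length of a word cut at weight
  \<open>t\<close> from above and below. For \<open>t\<close> between \<open>(1/8)^k\<close> and
  \<open>(1/4)^k\<close> both can be taken of order \<open>k\<close>, so \<open>R\<close> is far
  below \<open>2^k\<close> and \<open>\<rho> ^ m\<close> beats the quadratic factor.\<close>

lemma eventually_stopping_parameters:
  fixes a \<rho> :: real
  assumes "0 < a" "0 < \<rho>" "\<rho> < 1"
  shows "\<exists>k\<^sub>0. \<forall>k\<ge>k\<^sub>0. \<forall>t :: real. (1 / 8) ^ k \<le> t \<longrightarrow> t \<le> (1 / 4) ^ k \<longrightarrow>
    (\<exists>R m. \<rho> ^ R \<le> t \<and> t \<le> a ^ m \<and> R \<le> 2 ^ k \<and> real R * real R * \<rho> ^ m \<le> 1)"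
proof -
  obtain c\<^sub>1 where c1: "\<rho> ^ c\<^sub>1 < 1 / 8" using real_arch_pow_inv[of "1 / 8" \<rho>] assms by auto
  obtain c\<^sub>2' where "(1 / 4) ^ c\<^sub>2' < a" using real_arch_pow_inv[of a "1 / 4"] assms by auto
  \<comment> \<open>The exponent is raised by one to make it positive, since it is divided by
    below.\<close>
  moreover have "(1 / 4 :: real) ^ Suc c\<^sub>2' \<le> (1 / 4) ^ c\<^sub>2'" by (intro power_decreasing) auto
  ultimately have "(1 / 4) ^ Suc c\<^sub>2' \<le> a" by linarith
  then obtain c\<^sub>2 where c2: "(1 / 4) ^ c\<^sub>2 \<le> a" "c\<^sub>2 > 0" by blast
  have lim: "(\<lambda>n. C * (real n * x ^ n)) \<longlonglongrightarrow> 0" if "0 < x" "x < 1" for x C :: real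
    using powser_times_n_limit_0[of x] that by (intro tendsto_mult_right_zero) auto
  have "eventually (\<lambda>k. c\<^sub>1 * (real k * (1 / 2) ^ k) < 1) sequentially"
    by (rule order_tendstoD(2)[OF lim]) auto
  then obtain k\<^sub>1 where k1: "\<And>k. k \<ge> k\<^sub>1 \<Longrightarrow> c\<^sub>1 * (real k * (1 / 2) ^ k) < 1"
    by (auto simp: eventually_sequentially)
  \<comment> \<open>Since \<open>R\<close> is at most \<open>c\<^sub>1 * c\<^sub>2 * Suc m\<close>,
    it suffices to bound \<open>R * sqrt \<rho> ^ m\<close> and square; dividing by
    \<open>sqrt \<rho>\<close> pays for passing from \<open>m\<close> to
    \<open>Suc m\<close>.\<close>
  define b where "b = real c\<^sub>1 * real c\<^sub>2 / sqrt \<rho>"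
  have "eventually (\<lambda>m. b * (real m * sqrt \<rho> ^ m) < 1) sequentially"
    using assms by (intro order_tendstoD(2)[OF lim]) auto
  then obtain m\<^sub>1 where m1: "\<And>m. m \<ge> m\<^sub>1 \<Longrightarrow> b * (real m * sqrt \<rho> ^ m) < 1"
    by (auto simp: eventually_sequentially)
  show ?thesis
  proof (rule exI[of _ "max k\<^sub>1 (c\<^sub>2 * m\<^sub>1)"], intro allI impI)
    fix k and t :: real assume k: "max k\<^sub>1 (c\<^sub>2 * m\<^sub>1) \<le> k" and t: "(1 / 8) ^ k \<le> t" "t \<le> (1 / 4) ^ k"
    define R where "R = c\<^sub>1 * k"
    define m where "m = k div c\<^sub>2"
    have "\<rho> ^ R = (\<rho> ^ c\<^sub>1) ^ k" by (simp add: R_def power_mult)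
    also have "\<dots> \<le> (1 / 8) ^ k" using c1 assms by (intro power_mono) auto
    finally have "\<rho> ^ R \<le> t" using t by simp
    moreover have "t \<le> a ^ m"
    proof -
      have "(1 / 4 :: real) ^ k \<le> (1 / 4) ^ (c\<^sub>2 * m)"
        by (intro power_decreasing) (auto simp: m_def)
      also have "\<dots> = ((1 / 4) ^ c\<^sub>2) ^ m" by (simp add: power_mult)
      also have "\<dots> \<le> a ^ m" using c2 by (intro power_mono) auto
      finally show ?thesis using t by simp
    qed
    moreover have "real R < 2 ^ k"
      using k1[of k] k by (simp add: R_def field_simps)
    then have "R \<le> 2 ^ k" by (metis less_imp_le of_nat_less_numeral_power_cancel_iff)
    moreover have "real R * real R * \<rho> ^ m \<le> 1"
    proof -
      have "k \<le> c\<^sub>2 * Suc m"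
        using mult_div_mod_eq[of c\<^sub>2 k] mod_less_divisor[OF c2(2), of k]
        unfolding m_def mult_Suc_right by linarith
      then have "R \<le> c\<^sub>1 * (c\<^sub>2 * Suc m)" unfolding R_def by (intro mult_left_mono) auto
      then have "real R \<le> real c\<^sub>1 * (real c\<^sub>2 * real (Suc m))"
        by (metis of_nat_le_iff of_nat_mult)
      then have "R * sqrt \<rho> ^ m \<le> (real c\<^sub>1 * (real c\<^sub>2 * real (Suc m))) * sqrt \<rho> ^ m"
        using assms by (intro mult_right_mono) auto
      also have "\<dots> = b * (real (Suc m) * sqrt \<rho> ^ Suc m)"
        using assms by (simp add: b_def)
      also have "m\<^sub>1 \<le> Suc m"
        using k c2(2) div_le_mono[of "c\<^sub>2 * m\<^sub>1" k c\<^sub>2] by (simp add: m_def)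
      then have "b * (real (Suc m) * sqrt \<rho> ^ Suc m) \<le> 1" using m1 less_imp_le by blast
      finally have "(R * sqrt \<rho> ^ m)\<^sup>2 \<le> 1\<^sup>2" using assms by (intro power_mono) auto
      moreover have "(R * sqrt \<rho> ^ m)\<^sup>2 = real R * real R * \<rho> ^ m"
        using assms by (simp add: power_mult_distrib power2_eq_square flip: power_mult_distrib)
      ultimately show ?thesis by simp
    qed
    ultimately show "\<exists>R m. \<rho> ^ R \<le> t \<and> t \<le> a ^ m \<and> R \<le> 2 ^ k \<and> real R * real R * \<rho> ^ m \<le> 1"
      by blast
  qed
qed

text \<open>Cauchy condensation with the weight \<open>n\<close>: the range from
  \<open>2^(k+m)\<close> to \<open>2^(k+m+1)\<close> has \<open>2^(k+m)\<close> terms, each at most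
  \<open>2 * 2^(k+m) * G (2^(k+m))\<close>. The shift \<open>m\<close> lets \<open>G\<close> be
  sampled at the far end of a block of positions.\<close>

lemma weighted_condensation:
  fixes G :: "nat \<Rightarrow> real"
  assumes mono: "\<And>i j. 1 \<le> i \<Longrightarrow> i \<le> j \<Longrightarrow> G j \<le> G i" and nonneg: "\<And>n. 1 \<le> n \<Longrightarrow> 0 \<le> G n"
    and summ: "summable (\<lambda>k. 4 ^ k * G (2 ^ (k + m)))"
  shows "summable (\<lambda>n. real (Suc n) * G (Suc n))"
proof -
  let ?h = "\<lambda>n. real n * G n" and ?a = "\<lambda>k. 4 ^ k * G (2 ^ (k + m))"
  define C where "C = (\<Sum>n\<in>{1..<2 ^ m}. ?h n)"
  have part: "(\<Sum>n\<in>{1..<2 ^ (K + m)}. ?h n) \<le> C + (\<Sum>k<K. 2 * 4 ^ m * ?a k)" for K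
  proof (induction K)
    case (Suc K)
    let ?N = "2 ^ (K + m) :: nat"
    have "{1..<2 ^ (Suc K + m)} = {1..<?N} \<union> {?N..<2 * ?N}" by auto
    then have "(\<Sum>n\<in>{1..<2 ^ (Suc K + m)}. ?h n) = (\<Sum>n\<in>{1..<?N}. ?h n) + (\<Sum>n\<in>{?N..<2 * ?N}. ?h n)"
      by (simp only:) (intro sum.union_disjoint, auto)
    also have "(\<Sum>n\<in>{?N..<2 * ?N}. ?h n) \<le> (\<Sum>n\<in>{?N..<2 * ?N}. real (2 * ?N) * G ?N)"
    proof (intro sum_mono mult_mono)
      fix n assume n: "n \<in> {?N..<2 * ?N}"
      have "1 \<le> ?N" by simp
      then show "G n \<le> G ?N" "0 \<le> G n" using n mono[of ?N n] nonneg[of n] by auto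
      show "real n \<le> real (2 * ?N)" using n by (intro of_nat_mono) simp
    qed auto
    also have "\<dots> = 2 * 4 ^ m * ?a K"
      by (simp add: power_add mult_ac power_mult_distrib[symmetric] flip: power2_eq_square)
         (simp add: power_mult_distrib power2_eq_square flip: power_mult_distrib)
    finally show ?case using Suc.IH by simp
  qed (simp add: C_def)
  have "summable (\<lambda>k. 2 * 4 ^ m * ?a k)" using summ by (rule summable_mult)
  moreover have "0 \<le> 2 * 4 ^ m * ?a k" for k using nonneg by simp
  ultimately have le: "(\<Sum>k<K. 2 * 4 ^ m * ?a k) \<le> (\<Sum>k. 2 * 4 ^ m * ?a k)" for K
    by (intro sum_le_suminf) auto
  show ?thesis
  proof (rule summableI_nonneg_bounded)
    fix n
    have "(\<Sum>i<n. real (Suc i) * G (Suc i)) = (\<Sum>i\<in>{1..<Suc n}. ?h i)"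
      by (intro sum.reindex_bij_witness[of _ "\<lambda>i. i - 1" Suc]) auto
    also have "\<dots> \<le> (\<Sum>i\<in>{1..<2 ^ (n + m)}. ?h i)"
    proof (intro sum_mono2)
      have "Suc n \<le> 2 ^ n" by (simp add: Suc_le_eq)
      also have "(2 :: nat) ^ n \<le> 2 ^ (n + m)" by (intro power_increasing) auto
      finally show "{1..<Suc n} \<subseteq> {1..<2 ^ (n + m)}" by auto
    qed (use nonneg in auto)
    also have "\<dots> \<le> C + (\<Sum>k. 2 * 4 ^ m * ?a k)" using part[of n] le[of n] by linarith
    finally show "(\<Sum>i<n. real (Suc i) * G (Suc i)) \<le> C + (\<Sum>k. 2 * 4 ^ m * ?a k)" .
  qed (use nonneg in auto)
qed

text \<open>The terms of a convergent series tend to zero, so the truncation at 1 is eventually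
  inactive.\<close>

lemma summable_min_one:
  fixes f :: "nat \<Rightarrow> real"
  assumes "summable (\<lambda>k. min (f k) 1)"
  shows "summable f"
proof -
  have "eventually (\<lambda>k. min (f k) 1 < 1) sequentially"
    by (rule order_tendstoD(2)[OF summable_LIMSEQ_zero[OF assms]]) simp
  then have "eventually (\<lambda>k. min (f k) 1 = f k) sequentially"
    by eventually_elim auto
  then have "summable (\<lambda>k. min (f k) 1) \<longleftrightarrow> summable f" by (rule summable_cong)
  then show ?thesis using assms by simp
qed

text \<open>Here \<open>t k\<close> is the weight threshold used in block \<open>k\<close>.
  Divergence survives the cap at \<open>(1/4)^k\<close>, and the discarded indices have
  \<open>4^k * t k\<close> below \<open>(1/2)^k\<close>, which is summable.\<close>

lemma not_summable_truncated:
  fixes G :: "nat \<Rightarrow> real"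
  assumes mono: "\<And>i j. 1 \<le> i \<Longrightarrow> i \<le> j \<Longrightarrow> G j \<le> G i" and nonneg: "\<And>n. 1 \<le> n \<Longrightarrow> 0 \<le> G n"
    and div: "\<not> summable (\<lambda>n. real (Suc n) * G (Suc n))" and "0 < C"
    and t: "\<And>k. t k = min (G (2 ^ (k + m)) / 2) ((1 / 4) ^ k)"
  shows "\<not> summable (\<lambda>k. if k\<^sub>0 \<le> k \<and> (1 / 8) ^ k \<le> t k then C * (4 ^ k * t k) else 0)"
proof
  let ?c = "\<lambda>k. if k\<^sub>0 \<le> k \<and> (1 / 8) ^ k \<le> t k then C * (4 ^ k * t k) else 0"
  assume summ: "summable ?c"
  have t_nonneg: "0 \<le> t k" for k using nonneg by (simp add: t)
  have "summable (\<lambda>k. ?c k / C + (1 / 2) ^ k)"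
    by (intro summable_add summable_divide summ summable_geometric) auto
  moreover have "norm (4 ^ k * t k) \<le> ?c k / C + (1 / 2) ^ k" if "k \<ge> k\<^sub>0" for k
  proof (cases "(1 / 8) ^ k \<le> t k")
    case False
    then have "4 ^ k * t k \<le> 4 ^ k * (1 / 8) ^ k" by simp
    also have "\<dots> = (1 / 2) ^ k" by (simp flip: power_mult_distrib)
    finally show ?thesis using False t_nonneg by simp
  qed (use that t_nonneg \<open>0 < C\<close> in simp)
  ultimately have summ_t: "summable (\<lambda>k. 4 ^ k * t k)" by (rule summable_comparison_test')
  have t_eq: "4 ^ k * t k = min (4 ^ k * G (2 ^ (k + m)) / 2) 1" for k
  proof -
    have "4 ^ k * t k = min (4 ^ k * (G (2 ^ (k + m)) / 2)) (4 ^ k * (1 / 4) ^ k)"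
      by (auto simp: t min_mult_distrib_left)
    then show ?thesis by (simp flip: power_mult_distrib)
  qed
  have "summable (\<lambda>k. 4 ^ k * G (2 ^ (k + m)) / 2)"
    by (rule summable_min_one[OF summ_t[unfolded t_eq]])
  from summable_mult[OF this, of 2] have "summable (\<lambda>k. 4 ^ k * G (2 ^ (k + m)))" by simp
  then have "summable (\<lambda>n. real (Suc n) * G (Suc n))"
    by (rule weighted_condensation[where G = G and m = m, rotated 2]) (fact mono nonneg)+
  then show False using div by contradiction
qed

subsection \<open>Bernoulli weights on finite words\<close>

locale letter_weights =
  fixes p :: "'a::finite \<Rightarrow> real"
  assumes p_pos: "0 < p a" and p_sum: "(\<Sum>a\<in>UNIV. p a) = 1"
begin

text \<open>The Bernoulli mass of the cylinder of sequences that start with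
  \<open>w\<close>.\<close>

definition wt :: "'a list \<Rightarrow> real"
  where "wt w = prod_list (map p w)"

text \<open>Expectation of \<open>F\<close> over a word of \<open>n\<close> independent letters with
  law \<open>p\<close>. The recursion keeps all probability estimates on finite words elementary;
  the measure enters only at the end.\<close>

primrec wexp :: "nat \<Rightarrow> ('a list \<Rightarrow> real) \<Rightarrow> real" where
  "wexp 0 F = F []"
| "wexp (Suc n) F = (\<Sum>a\<in>UNIV. p a * wexp n (\<lambda>w. F (a # w)))"

lemma wt_simps [simp]: "wt [] = 1" "wt (a # w) = p a * wt w" "wt (u @ v) = wt u * wt v"
  by (simp_all add: wt_def)

lemma wt_pos: "0 < wt w"
  by (induction w) (auto simp: p_pos)

lemma wexp_cong: "(\<And>w. length w = n \<Longrightarrow> F w = G w) \<Longrightarrow> wexp n F = wexp n G"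
proof (induction n arbitrary: F G)
  case (Suc n)
  have "wexp n (\<lambda>w. F (a # w)) = wexp n (\<lambda>w. G (a # w))" for a
    by (rule Suc.IH) (simp add: Suc.prems)
  then show ?case by simp
qed simp

lemma wexp_mono: "(\<And>w. length w = n \<Longrightarrow> F w \<le> G w) \<Longrightarrow> wexp n F \<le> wexp n G"
proof (induction n arbitrary: F G)
  case (Suc n)
  have "wexp n (\<lambda>w. F (a # w)) \<le> wexp n (\<lambda>w. G (a # w))" for a
    by (rule Suc.IH) (simp add: Suc.prems)
  then show ?case by (auto intro!: sum_mono mult_left_mono less_imp_le[OF p_pos])
qed simp

lemma wexp_const [simp]: "wexp n (\<lambda>w. c) = c"
  by (induction n) (auto simp: sum_distrib_right[symmetric] p_sum)

lemma wexp_add: "wexp n (\<lambda>w. F w + G w) = wexp n F + wexp n G"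
  by (induction n arbitrary: F G) (auto simp: algebra_simps sum.distrib)

lemma wexp_cmult: "wexp n (\<lambda>w. c * F w) = c * wexp n F"
  by (induction n arbitrary: F) (auto simp: sum_distrib_left mult_ac)

lemma wexp_diff: "wexp n (\<lambda>w. F w - G w) = wexp n F - wexp n G"
  using wexp_add[of n F "\<lambda>w. (-1) * G w"] wexp_cmult[of n "-1" G] by simp

lemma wexp_sum: "wexp n (\<lambda>w. \<Sum>i\<in>I. F i w) = (\<Sum>i\<in>I. wexp n (F i))"
  by (induction I rule: infinite_finite_induct) (auto simp: wexp_add)

lemma wexp_nonneg: "(\<And>w. length w = n \<Longrightarrow> 0 \<le> F w) \<Longrightarrow> 0 \<le> wexp n F"
  using wexp_mono[of n "\<lambda>_. 0" F] by simp

lemma wexp_le_const: "(\<And>w. length w = n \<Longrightarrow> F w \<le> c) \<Longrightarrow> wexp n F \<le> c"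
  using wexp_mono[of n F "\<lambda>_. c"] by simp

text \<open>Independence of consecutive pieces of a random word; later proofs condition on the first
  piece through this identity.\<close>

lemma wexp_append: "wexp (m + n) F = wexp m (\<lambda>u. wexp n (\<lambda>v. F (u @ v)))"
  by (induction m arbitrary: F) auto

lemma wexp_swap: "wexp m (\<lambda>x. wexp n (\<lambda>y. F x y)) = wexp n (\<lambda>y. wexp m (\<lambda>x. F x y))"
  by (induction m arbitrary: F) (auto simp: wexp_sum wexp_cmult)

lemma wexp_prefix: "length u \<le> n \<Longrightarrow> wexp n (\<lambda>w. of_bool (prefix u w)) = wt u"
proof (induction u arbitrary: n)
  case (Cons b u)
  then obtain m where n: "n = Suc m" "length u \<le> m" by (cases n) auto
  have "wexp m (\<lambda>w. of_bool (prefix (b # u) (a # w))) = of_bool (a = b) * wt u" for a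
    using Cons.IH[OF n(2)] by (cases "a = b") simp_all
  then have "wexp n (\<lambda>w. of_bool (prefix (b # u) w)) = (\<Sum>a\<in>UNIV. if a = b then p a * wt u else 0)"
    unfolding n wexp.simps by (intro sum.cong) auto
  then show ?case by simp
qed auto

lemma wexp_prefix_at:
  assumes "c + length u \<le> n"
  shows "wexp n (\<lambda>w. of_bool (prefix u (drop c w))) = wt u"
proof -
  have "wexp (c + (n - c)) (\<lambda>w. of_bool (prefix u (drop c w)))
      = wexp c (\<lambda>v. wexp (n - c) (\<lambda>w. of_bool (prefix u w)))"
    unfolding wexp_append by (rule wexp_cong) auto
  then show ?thesis using assms by (simp add: wexp_prefix)
qed

text \<open>The occurrence of \<open>v\<close> may overlap that of \<open>u\<close> from the
  \<open>j\<close>-th letter of \<open>u\<close> on. Only the letters of \<open>u\<close> before the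
  overlap are independent of \<open>v\<close>; the rest of \<open>u\<close> is dropped, whence an
  inequality.\<close>

lemma wexp_two_prefixes:
  assumes "c + j + length v \<le> n"
  shows "wexp n (\<lambda>w. of_bool (prefix u (drop c w) \<and> prefix v (drop (c + j) w)))
    \<le> wt (take j u) * wt v"
proof -
  let ?F = "\<lambda>w. of_bool (prefix u (drop c w) \<and> prefix v (drop (c + j) w)) :: real"
  have *: "prefix (take j u) (drop c x)" if "length x = c + j" "prefix u (drop c (x @ y))" for x y
  proof -
    have "prefix (take j u) (drop c (x @ y))"
      using take_is_prefix that(2) prefix_order.trans by blast
    then show ?thesis using that(1) by (auto intro: prefix_length_prefix)
  qed
  have "wexp ((c + j) + (n - (c + j))) ?F
      \<le> wexp (c + j) (\<lambda>x. of_bool (prefix (take j u) (drop c x)) * wt v)"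
    unfolding wexp_append[of "c + j"]
  proof (rule wexp_mono)
    fix x :: "'a list" assume x: "length x = c + j"
    have "wexp (n - (c + j)) (\<lambda>y. ?F (x @ y))
        \<le> wexp (n - (c + j)) (\<lambda>y. of_bool (prefix (take j u) (drop c x)) * of_bool (prefix v y))"
      using *[OF x] x by (intro wexp_mono) auto
    also have "\<dots> = of_bool (prefix (take j u) (drop c x)) * wt v"
      using assms by (simp only: wexp_cmult) (simp add: wexp_prefix)
    finally show "wexp (n - (c + j)) (\<lambda>y. ?F (x @ y))
        \<le> of_bool (prefix (take j u) (drop c x)) * wt v" .
  qed
  also have "\<dots> = wt v * wexp (c + j) (\<lambda>x. of_bool (prefix (take j u) (drop c x)))"
    by (subst wexp_cmult[symmetric]) (simp add: mult_ac)
  also have "\<dots> = wt (take j u) * wt v"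
    by (subst wexp_prefix_at) auto
  finally show ?thesis using assms by simp
qed

end

section \<open>Self-repetitions and words stopped at a given weight\<close>

locale bounded_letter_weights = letter_weights +
  fixes pmin \<rho> :: real
  assumes pmin: "0 < pmin" "\<And>a. pmin \<le> p a" and \<rho>: "\<rho> < 1" "\<And>a. p a \<le> \<rho>"
begin

lemma \<rho>_pos: "0 < \<rho>" and pmin_le_\<rho>: "pmin \<le> \<rho>"
  using pmin \<rho> by (meson less_le_trans order.trans)+

lemma wt_le: "wt w \<le> \<rho> ^ length w"
  by (induction w) (auto intro!: mult_mono \<rho> less_imp_le[OF wt_pos] less_imp_le[OF \<rho>_pos])

lemma wt_ge: "pmin ^ length w \<le> wt w"
  by (induction w) (auto intro!: mult_mono pmin less_imp_le[OF p_pos] zero_le_power less_imp_le[OF pmin(1)])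

text \<open>The letter at \<open>c' + b\<close> is independent of all earlier ones, among them the
  letter at \<open>c + b\<close>, and agrees with it with probability at most \<open>\<rho>\<close>.
  An overlap of the two windows therefore does no harm.\<close>

lemma wexp_repeat_less:
  assumes "c < c'" "c' + b \<le> n"
  shows "wexp n (\<lambda>x. of_bool (\<forall>a<b. x ! (c + a) = x ! (c' + a))) \<le> \<rho> ^ b"
  using assms
proof (induction b arbitrary: n)
  case (Suc b)
  let ?A = "\<lambda>b x. of_bool (\<forall>a<b. x ! (c + a) = x ! (c' + a)) :: real"
  have n: "n = (c' + b) + (1 + (n - Suc (c' + b)))" using Suc.prems by simp
  have "wexp ((c' + b) + (1 + (n - Suc (c' + b)))) (?A (Suc b))
      \<le> wexp (c' + b) (\<lambda>x. \<rho> * ?A b x)"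
    unfolding wexp_append[of "c' + b"]
  proof (rule wexp_mono)
    fix x :: "'a list" assume x: "length x = c' + b"
    have "wexp (1 + (n - Suc (c' + b))) (\<lambda>v. ?A (Suc b) (x @ v))
      = wexp (1 + (n - Suc (c' + b))) (\<lambda>v. ?A b x * of_bool (prefix [x ! (c + b)] v))"
    proof (rule wexp_cong)
      fix v :: "'a list" assume v: "length v = 1 + (n - Suc (c' + b))"
      then obtain h v' where [simp]: "v = h # v'" by (cases v) auto
      have "(x @ v) ! (c' + b) = h" "(x @ v) ! (c + b) = x ! (c + b)"
        using x \<open>c < c'\<close> by (auto simp: nth_append)
      moreover have "(x @ v) ! (c' + a) = x ! (c' + a)" "(x @ v) ! (c + a) = x ! (c + a)" if "a < b" for a
        using x that \<open>c < c'\<close> by (auto simp: nth_append)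
      ultimately have "(\<forall>a<Suc b. (x @ v) ! (c + a) = (x @ v) ! (c' + a)) \<longleftrightarrow>
        (\<forall>a<b. x ! (c + a) = x ! (c' + a)) \<and> x ! (c + b) = h"
        unfolding less_Suc_eq by metis
      then show "?A (Suc b) (x @ v) = ?A b x * of_bool (prefix [x ! (c + b)] v)"
        by simp
    qed
    also have "\<dots> = ?A b x * p (x ! (c + b))"
      by (simp only: wexp_cmult) (subst wexp_prefix, auto)
    also have "\<dots> \<le> \<rho> * ?A b x" using \<rho>(2) by simp
    finally show "wexp (1 + (n - Suc (c' + b))) (\<lambda>v. ?A (Suc b) (x @ v)) \<le> \<rho> * ?A b x" .
  qed
  also have "\<dots> \<le> \<rho> * \<rho> ^ b"
    unfolding wexp_cmult using Suc \<rho>_pos by (intro mult_left_mono) auto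
  finally show ?case using n by simp
qed auto

lemma wexp_repeat:
  assumes "c \<noteq> c'" "c + b \<le> n" "c' + b \<le> n"
  shows "wexp n (\<lambda>x. of_bool (\<forall>a<b. x ! (c + a) = x ! (c' + a))) \<le> \<rho> ^ b"
proof (cases "c < c'")
  case False
  then show ?thesis using wexp_repeat_less[of c' c b n] assms by (simp add: eq_commute)
qed (use assms wexp_repeat_less in auto)

text \<open>Meaningful only if some prefix of \<open>z\<close> has weight at most \<open>t\<close>.\<close>

definition stopped :: "real \<Rightarrow> 'a list \<Rightarrow> 'a list"
  where "stopped t z = take (LEAST i. wt (take i z) \<le> t) z"

lemma prefix_stopped: "prefix (stopped t z) z"
  by (simp add: stopped_def take_is_prefix)

context
  fixes t :: real and R :: nat
  assumes t: "0 < t" "t < 1" and R: "\<rho> ^ R \<le> t"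
begin

context
  fixes z :: "'a list" assumes z: "R \<le> length z"
begin

lemma wt_take_R: "wt (take R z) \<le> t"
  using wt_le[of "take R z"] R z by simp

lemma wt_stopped_le: "wt (stopped t z) \<le> t"
  unfolding stopped_def by (rule LeastI) (rule wt_take_R)

lemma length_stopped: "length (stopped t z) = (LEAST i. wt (take i z) \<le> t)"
  and length_stopped_le: "length (stopped t z) \<le> R"
  using z Least_le[of "\<lambda>i. wt (take i z) \<le> t" R] wt_take_R by (auto simp: stopped_def)

text \<open>One letter before the cut the weight still exceeds \<open>t\<close>, and the last letter
  costs at most a factor \<open>pmin\<close>.\<close>

lemma wt_stopped_ge: "pmin * t \<le> wt (stopped t z)"
proof -
  define i where "i = (LEAST i. wt (take i z) \<le> t)"
  have s: "stopped t z = take i z" "length (stopped t z) = i"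
    using length_stopped by (auto simp: stopped_def i_def)
  \<comment> \<open>The empty word has weight 1, which exceeds \<open>t\<close>.\<close>
  have "i \<noteq> 0" using wt_stopped_le t s by (intro notI) auto
  then obtain j where j: "i = Suc j" by (cases i) auto
  have "t < wt (take j z)"
    using not_less_Least[of j "\<lambda>i. wt (take i z) \<le> t"] j by (auto simp: i_def)
  moreover have "j < length z" using s j length_stopped_le z by simp
  then have "wt (take i z) = wt (take j z) * p (z ! j)"
    by (simp add: j take_Suc_conv_app_nth)
  ultimately have "t * pmin \<le> wt (take i z)"
    using pmin t by (auto intro!: mult_mono)
  then show ?thesis by (simp add: s mult.commute)
qed

text \<open>A word with fewer than \<open>m\<close> letters weighs more than
  \<open>pmin ^ m\<close>, so it has not yet reached the threshold.\<close>

lemma length_stopped_ge: "t \<le> pmin ^ m \<Longrightarrow> m \<le> length (stopped t z)"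
proof (rule ccontr)
  assume m: "t \<le> pmin ^ m" "\<not> m \<le> length (stopped t z)"
  then have "pmin ^ m < pmin ^ length (stopped t z)"
    using pmin pmin_le_\<rho> \<rho> by (intro power_strict_decreasing) auto
  also have "\<dots> \<le> wt (stopped t z)" by (rule wt_ge)
  also have "\<dots> \<le> t" by (rule wt_stopped_le)
  finally show False using m by simp
qed

text \<open>The cut is a stopping time: whether it happens at a position depends only on the letters
  read so far. Stopped words thus form a prefix code.\<close>

lemma stopped_eqI:
  assumes "prefix (stopped t z) z'"
  shows "stopped t z' = stopped t z"
proof -
  define i where "i = (LEAST i. wt (take i z) \<le> t)"
  have i: "stopped t z = take i z" "length (take i z) = i"
    using length_stopped by (auto simp: stopped_def i_def)
  obtain z'' where z'': "z' = take i z @ z''" using assms i by (auto elim: prefixE)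
  have tk: "take j z' = take j z" if "j \<le> i" for j
    using that i by (simp add: z'' min_def)
  have "wt (take i z') \<le> t" using wt_stopped_le i tk by simp
  moreover have "i \<le> j" if "wt (take j z') \<le> t" for j
  proof (rule ccontr)
    assume "\<not> i \<le> j"
    then show False using that tk[of j] not_less_Least[of j "\<lambda>i. wt (take i z) \<le> t"]
      by (auto simp: i_def)
  qed
  ultimately have "(LEAST j. wt (take j z') \<le> t) = i" by (intro Least_equality)
  then show ?thesis using i tk by (simp add: stopped_def)
qed

end

text \<open>A stopped word that starts both words is the stopped word of each. This symmetry, which
  a cut at fixed length has trivially, allows the roles of the two words to be exchanged.\<close>

lemma prefix_stopped_sym:
  "R \<le> length z \<Longrightarrow> R \<le> length z' \<Longrightarrow> prefix (stopped t z) z' \<longleftrightarrow> prefix (stopped t z') z"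
  using stopped_eqI prefix_stopped by metis

end

end

subsection \<open>Coincidences between two independent words\<close>

text \<open>The exponent is the distance of \<open>n\<close> and \<open>n'\<close>, written with
  truncated subtraction; each side of \<open>n\<close> contributes at most a full geometric
  series.\<close>

lemma sum_power_dist_le:
  fixes \<rho> :: real
  assumes "0 < \<rho>" "\<rho> < 1"
  shows "(\<Sum>n'<M. \<rho> ^ ((n - n') + (n' - n))) \<le> 2 / (1 - \<rho>)"
proof -
  have geom: "(\<Sum>i<N. \<rho> ^ i) \<le> 1 / (1 - \<rho>)" for N
    using assms by (subst sum_gp_strict) (auto intro!: divide_right_mono)
  have "(\<Sum>n'<M. \<rho> ^ ((n - n') + (n' - n)))
      \<le> (\<Sum>n'\<in>{..<n} \<union> {n..<n + M}. \<rho> ^ ((n - n') + (n' - n)))"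
    using assms by (intro sum_mono2) auto
  also have "\<dots> = (\<Sum>n'<n. \<rho> ^ ((n - n') + (n' - n))) + (\<Sum>n'\<in>{n..<n + M}. \<rho> ^ ((n - n') + (n' - n)))"
    by (intro sum.union_disjoint) auto
  also have "(\<Sum>n'<n. \<rho> ^ ((n - n') + (n' - n))) = (\<Sum>i<n. \<rho> ^ Suc i)"
    by (intro sum.reindex_bij_witness[of _ "\<lambda>i. n - Suc i" "\<lambda>i. n - Suc i"])
      (auto simp: Suc_diff_Suc simp flip: power_Suc)
  also have "\<dots> \<le> (\<Sum>i<n. \<rho> ^ i)" using assms by (intro sum_mono power_decreasing) auto
  also have "\<dots> \<le> 1 / (1 - \<rho>)" by (rule geom)
  also have "(\<Sum>n'\<in>{n..<n + M}. \<rho> ^ ((n - n') + (n' - n))) = (\<Sum>i<M. \<rho> ^ i)"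
    by (intro sum.reindex_bij_witness[of _ "\<lambda>i. n + i" "\<lambda>i. i - n"]) auto
  also have "\<dots> \<le> 1 / (1 - \<rho>)" by (rule geom)
  finally show ?thesis by simp
qed

section \<open>First and second moments of the number of coincidences\<close>

context bounded_letter_weights
begin

text \<open>The words \<open>x\<close> and \<open>y\<close> stand for the two independent halves of
  a block; the compared word is read off \<open>x\<close> and looked for in
  \<open>y\<close>.\<close>

definition hit :: "real \<Rightarrow> 'a list \<Rightarrow> 'a list \<Rightarrow> nat \<Rightarrow> nat \<Rightarrow> bool"
  where "hit t x y l n \<longleftrightarrow> prefix (stopped t (drop l x)) (drop n y)"

text \<open>Probability of two simultaneous coincidences: a summand of the second moment.\<close>

definition joint :: "real \<Rightarrow> nat \<Rightarrow> nat \<Rightarrow> nat \<Rightarrow> nat \<Rightarrow> nat \<Rightarrow> real"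
  where "joint t L l n l' n' =
    wexp L (\<lambda>x. wexp L (\<lambda>y. of_bool (hit t x y l n) * of_bool (hit t x y l' n')))"

lemma joint_commute: "joint t L l n l' n' = joint t L l' n' l n"
  by (simp add: joint_def mult.commute)

text \<open>Stopped words have length between \<open>m\<close> and \<open>R\<close>. Positions run
  below \<open>M\<close> in words of length \<open>2 * M\<close>, so \<open>R \<le> M\<close>
  guarantees that every stopped word fits.\<close>

context
  fixes t :: real and R m M :: nat
  assumes t: "0 < t" "t < 1" and R: "\<rho> ^ R \<le> t" and m: "t \<le> pmin ^ m" and RM: "R \<le> M"
begin

lemma m_le_R: "m \<le> R"
proof (rule ccontr)
  assume "\<not> m \<le> R"
  then have "\<rho> ^ m < \<rho> ^ R" using \<rho>_pos \<rho> by (intro power_strict_decreasing) auto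
  moreover have "pmin ^ m \<le> \<rho> ^ m" using pmin pmin_le_\<rho> by (intro power_mono) auto
  ultimately show False using m R by simp
qed

lemma hit_sym:
  assumes "length x = 2 * M" "length y = 2 * M" "l < M" "n < M"
  shows "hit t x y l n \<longleftrightarrow> hit t y x n l"
  unfolding hit_def using assms RM by (intro prefix_stopped_sym[OF t R]) auto

lemma joint_swap:
  assumes "l < M" "n < M" "l' < M" "n' < M"
  shows "joint t (2 * M) l n l' n' = joint t (2 * M) n l n' l'"
  unfolding joint_def
  by (subst wexp_swap) (intro wexp_cong, simp add: hit_sym[OF _ _ assms(1,2)] hit_sym[OF _ _ assms(3,4)])

text \<open>For fixed \<open>x\<close> the word is fixed, and it occurs at a given place of
  \<open>y\<close> with probability equal to its weight.\<close>

lemma wexp_hit_ge: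
  assumes "l < M" "n < M"
  shows "pmin * t \<le> wexp (2 * M) (\<lambda>x. wexp (2 * M) (\<lambda>y. of_bool (hit t x y l n)))"
proof -
  have "pmin * t \<le> wexp (2 * M) (\<lambda>y. of_bool (hit t x y l n))" if "length x = 2 * M" for x
  proof -
    have len: "R \<le> length (drop l x)" using that assms RM by simp
    show ?thesis unfolding hit_def
      using wt_stopped_ge[OF t R len] length_stopped_le[OF t R len] assms RM
      by (subst wexp_prefix_at) auto
  qed
  then show ?thesis using wexp_mono[of "2 * M" "\<lambda>_. pmin * t"] by simp
qed

lemma wexp_hit_hit_le:
  assumes x: "length x = 2 * M" and "l < M" "l' < M" "n + j < M"
  shows "wexp (2 * M) (\<lambda>y. of_bool (hit t x y l n) * of_bool (hit t x y l' (n + j)))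
    \<le> wt (take j (stopped t (drop l x))) * t"
proof -
  have len: "R \<le> length (drop l x)" "R \<le> length (drop l' x)" using assms RM by simp_all
  have "wexp (2 * M) (\<lambda>y. of_bool (hit t x y l n \<and> hit t x y l' (n + j)))
      \<le> wt (take j (stopped t (drop l x))) * wt (stopped t (drop l' x))"
    unfolding hit_def using length_stopped_le[OF t R len(2)] assms RM
    by (intro wexp_two_prefixes) auto
  also have "\<dots> \<le> wt (take j (stopped t (drop l x))) * t"
    using wt_stopped_le[OF t R len(2)] less_imp_le[OF wt_pos] by (intro mult_left_mono) auto
  finally show ?thesis by (simp add: of_bool_conj)
qed

lemma wt_take_stopped_le:
  assumes "length x = 2 * M" "l < M"
  shows "wt (take j (stopped t (drop l x))) \<le> \<rho> ^ min j m"
proof -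
  have len: "R \<le> length (drop l x)" using assms RM by simp
  have "wt (take j (stopped t (drop l x))) \<le> \<rho> ^ length (take j (stopped t (drop l x)))"
    by (rule wt_le)
  also have "\<dots> \<le> \<rho> ^ min j m"
    using length_stopped_ge[OF t R len m] \<rho> \<rho>_pos by (intro power_decreasing) auto
  finally show ?thesis .
qed

text \<open>A stopped word has length at most \<open>R\<close>, so the two occurrences occupy
  disjoint parts of \<open>y\<close> and are independent once \<open>x\<close> is fixed.\<close>

lemma joint_far:
  assumes "l < M" "l' < M" "n' < M" "n + R \<le> n'"
  shows "joint t (2 * M) l n l' n' \<le> t * t"
  unfolding joint_def
proof (rule wexp_le_const)
  fix x :: "'a list" assume x: "length x = 2 * M"
  have len: "R \<le> length (drop l x)" using x assms RM by simp
  have "wexp (2 * M) (\<lambda>y. of_bool (hit t x y l n) * of_bool (hit t x y l' (n + (n' - n))))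
      \<le> wt (take (n' - n) (stopped t (drop l x))) * t"
    using assms by (intro wexp_hit_hit_le x) auto
  also have "\<dots> \<le> t * t"
    using wt_stopped_le[OF t R len] length_stopped_le[OF t R len] assms t by simp
  finally show "wexp (2 * M) (\<lambda>y. of_bool (hit t x y l n) * of_bool (hit t x y l' n')) \<le> t * t"
    using assms by simp
qed

text \<open>On a common diagonal the first coincidence may already contain most of the second, so
  only the letters before the overlap give decay: \<open>j\<close> of them, of which
  \<open>m\<close> are guaranteed.\<close>

lemma joint_same_diagonal:
  assumes "l + j < M" "n + j < M"
  shows "joint t (2 * M) l n (l + j) (n + j) \<le> t * \<rho> ^ m + t * \<rho> ^ j"
  unfolding joint_def
proof (rule wexp_le_const)
  fix x :: "'a list" assume x: "length x = 2 * M"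
  have "wexp (2 * M) (\<lambda>y. of_bool (hit t x y l n) * of_bool (hit t x y (l + j) (n + j)))
      \<le> wt (take j (stopped t (drop l x))) * t"
    using assms by (intro wexp_hit_hit_le x) auto
  also have "\<dots> \<le> \<rho> ^ min j m * t"
    using wt_take_stopped_le[OF x, of l j] assms t by (intro mult_right_mono) auto
  also have "\<dots> \<le> t * \<rho> ^ m + t * \<rho> ^ j"
    using t \<rho>_pos by (auto simp: min_def)
  finally show "wexp (2 * M) (\<lambda>y. of_bool (hit t x y l n) * of_bool (hit t x y (l + j) (n + j)))
    \<le> t * \<rho> ^ m + t * \<rho> ^ j" .
qed

text \<open>Off the common diagonal, \<open>l' \<noteq> l + j\<close>, this is a genuine self-repetition of \<open>x\<close>, which is
  exponentially unlikely in \<open>m - j\<close>.\<close>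

lemma hit_hit_imp_repeat:
  assumes x: "length x = 2 * M" and y: "length y = 2 * M" and "l < M" "l' < M" "n + j < M"
    and "hit t x y l n" "hit t x y l' (n + j)" "a < m - j"
  shows "x ! (l + j + a) = x ! (l' + a)"
proof -
  let ?u = "stopped t (drop l x)" and ?v = "stopped t (drop l' x)"
  have len: "R \<le> length (drop l x)" "R \<le> length (drop l' x)" using assms RM by simp_all
  have "j + a < length ?u" "a < length ?v"
    using length_stopped_ge[OF t R _ m, of "drop l x"] length_stopped_ge[OF t R _ m, of "drop l' x"]
      len assms by auto
  moreover have nth: "u ! i = z ! i" if "prefix u z" "i < length u" for u z :: "'a list" and i
    using that by (auto elim!: prefixE simp: nth_append)
  ultimately have
    "?u ! (j + a) = drop l x ! (j + a)" "?u ! (j + a) = drop n y ! (j + a)"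
    "?v ! a = drop l' x ! a" "?v ! a = drop (n + j) y ! a"
    using assms(6,7) prefix_stopped[of t] unfolding hit_def by blast+
  then show ?thesis using x y assms m_le_R RM by (simp add: add_ac)
qed

text \<open>Two gains multiply: the \<open>min j m\<close> letters before the overlap in
  \<open>y\<close>, and the \<open>m - j\<close> letters of the self-repetition in \<open>x\<close>.
  Together they give \<open>\<rho> ^ m\<close> whatever \<open>j\<close> is.\<close>

lemma joint_other_diagonal:
  assumes "l < M" "l' < M" "n + j < M" "l' \<noteq> l + j"
  shows "joint t (2 * M) l n l' (n + j) \<le> t * \<rho> ^ m"
proof -
  let ?A = "\<lambda>x. of_bool (\<forall>a<m - j. x ! (l + j + a) = x ! (l' + a)) :: real"
  have "joint t (2 * M) l n l' (n + j) \<le> wexp (2 * M) (\<lambda>x. (t * \<rho> ^ min j m) * ?A x)"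
    unfolding joint_def
  proof (rule wexp_mono)
    fix x :: "'a list" assume x: "length x = 2 * M"
    let ?F = "\<lambda>y. of_bool (hit t x y l n) * of_bool (hit t x y l' (n + j)) :: real"
    have "wexp (2 * M) ?F \<le> wexp (2 * M) (\<lambda>y. ?A x * ?F y)"
      using hit_hit_imp_repeat[OF x _ assms(1-3)] by (intro wexp_mono) auto
    also have "\<dots> \<le> ?A x * (wt (take j (stopped t (drop l x))) * t)"
      unfolding wexp_cmult using assms by (intro mult_left_mono wexp_hit_hit_le x) auto
    also have "\<dots> \<le> ?A x * (\<rho> ^ min j m * t)"
      using wt_take_stopped_le[OF x, of l j] assms t by (intro mult_left_mono mult_right_mono) auto
    finally show "wexp (2 * M) ?F \<le> (t * \<rho> ^ min j m) * ?A x" by (simp add: mult_ac)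
  qed
  also have "\<dots> \<le> (t * \<rho> ^ min j m) * \<rho> ^ (m - j)"
    unfolding wexp_cmult
  proof (intro mult_left_mono)
    show "wexp (2 * M) ?A \<le> \<rho> ^ (m - j)"
    proof (cases "j < m")
      case True
      then show ?thesis using assms m_le_R RM by (intro wexp_repeat) auto
    qed simp
  qed (use t \<rho>_pos in auto)
  also have "\<dots> = t * \<rho> ^ m" by (auto simp: min_def simp flip: power_add)
  finally show ?thesis .
qed

text \<open>The three terms account for pairs at distance at least \<open>R\<close> in one of the
  coordinates, for pairs near in both, and for the slower decay along a common diagonal.\<close>

lemma joint_le:
  assumes "l < M" "n < M" "l' < M" "n' < M"
  shows "joint t (2 * M) l n l' n' \<le> t * t
    + t * \<rho> ^ m * (of_bool ((l - l') + (l' - l) < R) * of_bool ((n - n') + (n' - n) < R))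
    + t * (of_bool (l + n' = l' + n) * \<rho> ^ ((n - n') + (n' - n)))" (is "_ \<le> ?B l n l' n'")
proof -
  have main: "joint t (2 * M) l n l' n' \<le> ?B l n l' n'"
    if "l < M" "n < M" "l' < M" "n' < M" "n \<le> n'" for l n l' n'
  proof -
    have nonneg: "0 \<le> t * t" "0 \<le> t * \<rho> ^ m" "0 \<le> t * \<rho> ^ i" for i using t \<rho>_pos by auto
    consider "n + R \<le> n'" | "l + R \<le> l'" | "l' + R \<le> l"
      | "n' < n + R" "l' < l + R" "l < l' + R" "l + n' = l' + n"
      | "n' < n + R" "l' < l + R" "l < l' + R" "l + n' \<noteq> l' + n" by linarith
    then show ?thesis
    proof cases
      case 1
      then have "joint t (2 * M) l n l' n' \<le> t * t" using that by (intro joint_far) auto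
      then show ?thesis using nonneg by (auto intro: add_increasing2)
    next
      \<comment> \<open>The pairs are far apart in \<open>x\<close> only; exchanging
        \<open>x\<close> and \<open>y\<close> reduces this to the previous case.\<close>
      case 2
      then have "joint t (2 * M) l n l' n' \<le> t * t"
        using that by (subst joint_swap) (auto intro!: joint_far)
      then show ?thesis using nonneg by (auto intro: add_increasing2)
    next
      case 3
      then have "joint t (2 * M) l n l' n' \<le> t * t"
        using that by (subst joint_swap, simp_all, subst joint_commute) (auto intro!: joint_far)
      then show ?thesis using nonneg by (auto intro: add_increasing2)
    next
      case 4
      then have *: "l' = l + (n' - n)" using \<open>n \<le> n'\<close> by simp
      have "joint t (2 * M) l n (l + (n' - n)) (n + (n' - n)) \<le> t * \<rho> ^ m + t * \<rho> ^ (n' - n)"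
        using that * by (intro joint_same_diagonal) auto
      then have "joint t (2 * M) l n l' n' \<le> t * \<rho> ^ m + t * \<rho> ^ (n' - n)"
        using * \<open>n \<le> n'\<close> by simp
      also have "\<dots> \<le> ?B l n l' n'" using 4 \<open>n \<le> n'\<close> by auto
      finally show ?thesis .
    next
      case 5
      then have "joint t (2 * M) l n l' (n + (n' - n)) \<le> t * \<rho> ^ m"
        using that by (intro joint_other_diagonal) auto
      then show ?thesis using nonneg 5 that by (auto intro: add_increasing)
    qed
  qed
  show ?thesis
  proof (cases "n \<le> n'")
    case False
    then have "joint t (2 * M) l' n' l n \<le> ?B l' n' l n" using assms by (intro main) auto
    moreover have "?B l' n' l n = ?B l n l' n'"
      by (simp add: add.commute eq_commute[of "l' + n"])
    ultimately show ?thesis by (simp add: joint_commute)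
  qed (use assms main in auto)
qed

lemma sum_near_le: "(\<Sum>n'<M. of_bool ((n - n') + (n' - n) < R) :: real) \<le> 2 * real R"
proof -
  have "card {n'. n' < M \<and> (n - n') + (n' - n) < R} \<le> card {n + 1 - R..<n + R}"
    by (rule card_mono) auto
  also have "\<dots> \<le> 2 * R" by simp
  finally have "real (card {n'. n' < M \<and> (n - n') + (n' - n) < R}) \<le> 2 * real R" by linarith
  moreover have "(\<Sum>n'<M. of_bool ((n - n') + (n' - n) < R) :: real)
    = real (card {n'. n' < M \<and> (n - n') + (n' - n) < R})"
    by (simp add: sum.If_cases of_bool_def Int_def)
  ultimately show ?thesis by simp
qed

text \<open>Far pairs contribute at most \<open>t\<close> because \<open>M * M * t \<le> 1\<close>,
  the at most \<open>4 * R * R\<close> near pairs at most \<open>4 * t\<close>, and the diagonal a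
  two-sided geometric series.\<close>

lemma sum_joint_le:
  assumes "M * M * t \<le> 1" "R * R * \<rho> ^ m \<le> 1" "l < M" "n < M"
  shows "(\<Sum>l'<M. \<Sum>n'<M. joint t (2 * M) l n l' n') \<le> (5 + 2 / (1 - \<rho>)) * t"
proof -
  let ?N = "\<lambda>l l'. of_bool ((l - l') + (l' - l) < R) :: real"
  have "(\<Sum>l'<M. \<Sum>n'<M. joint t (2 * M) l n l' n') \<le>
    (\<Sum>l'<M. \<Sum>n'<M. t * t + t * \<rho> ^ m * (?N l l' * ?N n n')
      + t * (of_bool (l + n' = l' + n) * \<rho> ^ ((n - n') + (n' - n))))"
    using assms by (intro sum_mono joint_le) auto
  also have "\<dots> = (M * M * t) * t + t * \<rho> ^ m * ((\<Sum>l'<M. ?N l l') * (\<Sum>n'<M. ?N n n'))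
      + t * (\<Sum>l'<M. \<Sum>n'<M. of_bool (l + n' = l' + n) * \<rho> ^ ((n - n') + (n' - n)))"
    by (simp add: sum.distrib sum_product del: sum_of_bool_eq flip: sum_distrib_left)
  also have "(\<Sum>l'<M. \<Sum>n'<M. of_bool (l + n' = l' + n) * \<rho> ^ ((n - n') + (n' - n)))
      = (\<Sum>n'<M. (\<Sum>l'<M. of_bool (l + n' = l' + n)) * \<rho> ^ ((n - n') + (n' - n)))"
    unfolding sum_distrib_right by (rule sum.swap)
  also have "\<dots> \<le> (\<Sum>n'<M. 1 * \<rho> ^ ((n - n') + (n' - n)))"
  proof (intro sum_mono mult_right_mono)
    fix n'
    \<comment> \<open>For given \<open>n'\<close> at most one \<open>l'\<close> lies on the diagonal
      of \<open>(l, n)\<close>. If \<open>l + n' < n\<close> there is none, and the truncated index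
      only enlarges the bound.\<close>
    have "(\<Sum>l'<M. of_bool (l + n' = l' + n) :: real) \<le> (\<Sum>l'<M. if l' = l + n' - n then 1 else 0)"
      by (intro sum_mono) auto
    also have "\<dots> \<le> 1" by (subst sum.delta) auto
    finally show "(\<Sum>l'<M. of_bool (l + n' = l' + n) :: real) \<le> 1" .
  qed (use \<rho>_pos in auto)
  also have "\<dots> \<le> 2 / (1 - \<rho>)" using sum_power_dist_le \<rho>_pos \<rho> by simp
  also have "(\<Sum>l'<M. ?N l l') * (\<Sum>n'<M. ?N n n') \<le> (2 * real R) * (2 * real R)"
    by (intro mult_mono sum_near_le sum_nonneg) auto
  also have "t * \<rho> ^ m * ((2 * real R) * (2 * real R)) = 4 * (R * R * \<rho> ^ m) * t" by simp
  also have "\<dots> \<le> 4 * 1 * t" using assms t by (intro mult_right_mono mult_left_mono) auto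
  also have "(M * M * t) * t \<le> 1 * t" using assms t by (intro mult_right_mono) auto
  finally show ?thesis using t \<rho>_pos by (auto simp: algebra_simps)
qed

text \<open>The second moment method, in the form \<open>1\<^bsub>N > 0\<^esub> \<ge> 2 c N - c\<^sup>2 N\<^sup>2\<close>.\<close>

lemma hit_prob_ge:
  assumes "M * M * t \<le> 1" "R * R * \<rho> ^ m \<le> 1"
  shows "pmin\<^sup>2 / (5 + 2 / (1 - \<rho>)) * (M * M * t)
    \<le> wexp (2 * M) (\<lambda>x. wexp (2 * M) (\<lambda>y. of_bool (\<exists>l<M. \<exists>n<M. hit t x y l n)))"
proof -
  define C where "C = 5 + 2 / (1 - \<rho>)"
  \<comment> \<open>This value maximises \<open>2 * c * pmin - c\<^sup>2 * C\<close>, the lower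
    bound per unit of \<open>M * M * t\<close>.\<close>
  define c where "c = pmin / C"
  define N where "N x y = (\<Sum>l<M. \<Sum>n<M. of_bool (hit t x y l n) :: real)" for x y
  let ?E = "\<lambda>F. wexp (2 * M) (\<lambda>x. wexp (2 * M) (F x))"
  have "0 < C" using \<rho> by (auto simp: C_def intro!: add_pos_pos)
  then have "0 < c" using pmin by (simp add: c_def)
  have "real M * real M * (pmin * t) \<le> (\<Sum>l<M. \<Sum>n<M. ?E (\<lambda>x y. of_bool (hit t x y l n)))"
  proof -
    have "(\<Sum>l<M. \<Sum>n<M. pmin * t) \<le> (\<Sum>l<M. \<Sum>n<M. ?E (\<lambda>x y. of_bool (hit t x y l n)))"
      by (intro sum_mono wexp_hit_ge) auto
    then show ?thesis by simp
  qed
  also have "\<dots> = ?E N" by (simp add: N_def[abs_def] wexp_sum del: sum_of_bool_eq)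
  finally have EN: "pmin * (M * M * t) \<le> ?E N" by (simp add: mult_ac)
  have sq: "(N x y)\<^sup>2 = (\<Sum>l<M. \<Sum>n<M. \<Sum>l'<M. \<Sum>n'<M.
      of_bool (hit t x y l n) * of_bool (hit t x y l' n'))" for x y
    unfolding N_def power2_eq_square sum_distrib_left sum_distrib_right
    by (intro sum.cong refl mult.commute)
  have "?E (\<lambda>x y. (N x y)\<^sup>2) = (\<Sum>l<M. \<Sum>n<M. \<Sum>l'<M. \<Sum>n'<M. joint t (2 * M) l n l' n')"
    unfolding sq joint_def by (simp only: wexp_sum)
  also have "\<dots> \<le> (\<Sum>l<M. \<Sum>n<M. C * t)"
    unfolding C_def using assms by (intro sum_mono sum_joint_le) auto
  finally have EN2: "?E (\<lambda>x y. (N x y)\<^sup>2) \<le> C * (M * M * t)" by (simp add: mult_ac)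
  have "pmin\<^sup>2 / C * (M * M * t) = 2 * c * (pmin * (M * M * t)) - c\<^sup>2 * (C * (M * M * t))"
    using \<open>0 < C\<close> by (simp add: c_def power2_eq_square field_simps)
  also have "\<dots> \<le> 2 * c * ?E N - c\<^sup>2 * ?E (\<lambda>x y. (N x y)\<^sup>2)"
    using EN EN2 \<open>0 < c\<close> by (intro diff_mono mult_left_mono) auto
  also have "\<dots> = ?E (\<lambda>x y. 2 * c * N x y - c\<^sup>2 * (N x y)\<^sup>2)"
    by (simp only: wexp_cmult wexp_diff)
  also have "\<dots> \<le> ?E (\<lambda>x y. of_bool (\<exists>l<M. \<exists>n<M. hit t x y l n))"
  proof (intro wexp_mono)
    fix x y
    show "2 * c * N x y - c\<^sup>2 * (N x y)\<^sup>2 \<le> of_bool (\<exists>l<M. \<exists>n<M. hit t x y l n)"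
    proof (cases "\<exists>l<M. \<exists>n<M. hit t x y l n")
      case False
      then have "N x y = 0" by (auto simp: N_def intro!: sum.neutral)
      then show ?thesis by simp
    next
      case True
      have "0 \<le> (1 - c * N x y)\<^sup>2" by simp
      then have "2 * c * N x y - c\<^sup>2 * (N x y)\<^sup>2 \<le> 1"
        by (simp add: power2_eq_square algebra_simps)
      then show ?thesis using True by simp
    qed
  qed
  finally show ?thesis by (simp add: C_def)
qed

end
end

subsection \<open>Bernoulli measure and independent blocks\<close>

context letter_weights
begin

definition bern :: "'a stream measure"
  where "bern = stream_space (point_measure UNIV (\<lambda>a. ennreal (p a)))"

lemma prob_space_letters: "prob_space (point_measure UNIV (\<lambda>a. ennreal (p a)))"
  using p_sum less_imp_le[OF p_pos]
  by (intro prob_spaceI) (simp add: space_point_measure emeasure_point_measure_finite sum_ennreal)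

lemma prob_space_bern: "prob_space bern"
  unfolding bern_def by (rule prob_space.prob_space_stream_space[OF prob_space_letters])

lemma sets_bern [measurable_cong]: "sets bern = sets (stream_space (count_space UNIV))"
  unfolding bern_def by (rule sets_stream_space_cong) (simp add: sets_point_measure)

lemma space_bern [simp]: "space bern = UNIV"
  by (simp add: bern_def space_stream_space space_point_measure)

lemma sets_shift:
  assumes [measurable]: "A \<in> sets bern"
  shows "{\<omega>. w @- \<omega> \<in> A} \<in> sets bern"
proof (induction w)
  case (Cons a w)
  have [measurable]: "(\<lambda>\<omega>. v @- \<omega>) \<in> measurable bern bern" for v
  proof (induction v)
    case (Cons b v)
    then have [measurable]: "(\<lambda>\<omega>. v @- \<omega>) \<in> measurable bern (stream_space (count_space UNIV))"
      by (simp cong: measurable_cong_sets add: sets_bern)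
    have "(\<lambda>\<omega>. b ## (v @- \<omega>)) \<in> measurable bern (stream_space (count_space UNIV))"
      by measurable
    then show ?case by (simp cong: measurable_cong_sets add: sets_bern)
  qed simp
  have "{\<omega> \<in> space bern. (a # w) @- \<omega> \<in> A} \<in> sets bern" by measurable
  then show ?case by simp
qed (use assms in simp)

text \<open>Conditioning on the first \<open>n\<close> letters: what follows them is again
  distributed by \<open>bern\<close>.\<close>

lemma measure_bern_shift:
  assumes "A \<in> sets bern"
  shows "measure bern A = wexp n (\<lambda>w. measure bern {\<omega>. w @- \<omega> \<in> A})"
  using assms
proof (induction n arbitrary: A)
  case (Suc n)
  interpret prob_space bern by (rule prob_space_bern)
  have "emeasure bern A = (\<integral>\<^sup>+a. emeasure bern {\<omega>. a ## \<omega> \<in> A} \<partial>point_measure UNIV (\<lambda>a. ennreal (p a)))"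
    using prob_space.emeasure_stream_space[OF prob_space_letters, of A] Suc.prems
    by (simp flip: bern_def)
  also have "\<dots> = (\<Sum>a\<in>UNIV. ennreal (p a) * emeasure bern {\<omega>. a ## \<omega> \<in> A})"
    by (simp add: nn_integral_point_measure_finite)
  also have "\<dots> = ennreal (\<Sum>a\<in>UNIV. p a * measure bern {\<omega>. a ## \<omega> \<in> A})"
    using less_imp_le[OF p_pos]
    by (subst sum_ennreal[symmetric]) (auto simp: emeasure_eq_measure ennreal_mult)
  finally have "measure bern A = (\<Sum>a\<in>UNIV. p a * measure bern {\<omega>. a ## \<omega> \<in> A})"
    using less_imp_le[OF p_pos] by (simp add: emeasure_eq_measure sum_nonneg)
  also have "\<dots> = (\<Sum>a\<in>UNIV. p a * wexp n (\<lambda>w. measure bern {\<omega>. w @- \<omega> \<in> {\<omega>. a ## \<omega> \<in> A}}))"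
    using sets_shift[OF Suc.prems, of "[_]"] by (intro sum.cong refl arg_cong2[of _ _ _ _ "(*)"] Suc.IH) simp
  finally show ?case by simp
qed simp

lemma measurable_stake_bern: "Measurable.pred bern (\<lambda>\<omega>. Q (stake n \<omega>))"
proof -
  have "Measurable.pred (stream_space (count_space UNIV)) (\<lambda>\<omega> :: 'a stream. Q (stake n \<omega>))"
    by measurable
  then show ?thesis by (simp cong: measurable_cong_sets add: sets_bern)
qed

lemma sets_stake: "{\<omega>. Q (stake n \<omega>)} \<in> sets bern"
  using measurable_stake_bern[of Q n] by (simp add: pred_def)

lemma measure_stake: "measure bern {\<omega>. Q (stake n \<omega>)} = wexp n (\<lambda>w. of_bool (Q w))"
proof -
  interpret prob_space bern by (rule prob_space_bern)
  have "measure bern {\<omega>. Q (stake n \<omega>)} = wexp n (\<lambda>w. measure bern {\<omega>. w @- \<omega> \<in> {\<omega>. Q (stake n \<omega>)}})"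
    by (rule measure_bern_shift[OF sets_stake])
  also have "\<dots> = wexp n (\<lambda>w. of_bool (Q w))"
    using prob_space by (intro wexp_cong) (auto simp: stake_shift)
  finally show ?thesis .
qed

text \<open>These are the positions from \<open>4 * 2^k\<close> up to \<open>8 * 2^k\<close>.
  Successive blocks are adjacent, and each is as long as everything before it.\<close>

definition block :: "nat \<Rightarrow> 'a list \<Rightarrow> 'a list"
  where "block k w = take (4 * 2 ^ k) (drop (4 * 2 ^ k) w)"

text \<open>The first \<open>8 * 2^(K+j)\<close> letters split into two equal halves: the first
  contains all earlier blocks, the second is block \<open>K + j\<close>. Their independence yields
  one factor per block.\<close>

lemma wexp_no_good_block:
  assumes c: "\<And>k. c k \<le> wexp (4 * 2 ^ k) (\<lambda>b. of_bool (good k b))"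
  shows "wexp (4 * 2 ^ (K + j)) (\<lambda>w. of_bool (\<forall>k\<in>{K..<K + j}. \<not> good k (block k w)))
    \<le> (\<Prod>k\<in>{K..<K + j}. 1 - c k)"
proof (induction j)
  case (Suc j)
  let ?N = "4 * 2 ^ (K + j) :: nat"
  let ?A = "\<lambda>j w. of_bool (\<forall>k\<in>{K..<K + j}. \<not> good k (block k w)) :: real"
  have c1: "c k \<le> 1" for k
    using c[of k] wexp_le_const[of "4 * 2 ^ k" "\<lambda>b. of_bool (good k b)" 1] by force
  have "wexp (?N + ?N) (?A (Suc j)) \<le> wexp ?N (\<lambda>u. (1 - c (K + j)) * ?A j u)"
    unfolding wexp_append[of ?N ?N]
  proof (rule wexp_mono)
    fix u :: "'a list" assume u: "length u = ?N"
    have old: "block k (u @ v) = block k u" if "k < K + j" for k v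
    proof -
      have "(2 :: nat) * 2 ^ k \<le> 2 ^ (K + j)"
        using that power_increasing[of "Suc k" "K + j" "2 :: nat"] by simp
      then show ?thesis using u by (simp add: block_def)
    qed
    have "wexp ?N (\<lambda>v. ?A (Suc j) (u @ v)) = wexp ?N (\<lambda>v. ?A j u * (1 - of_bool (good (K + j) v)))"
    proof (rule wexp_cong)
      fix v :: "'a list" assume v: "length v = ?N"
      have new: "block (K + j) (u @ v) = v" using u v by (simp add: block_def)
      show "?A (Suc j) (u @ v) = ?A j u * (1 - of_bool (good (K + j) v))"
      proof -
        have "{K..<K + Suc j} = insert (K + j) {K..<K + j}" by auto
        then have "(\<forall>k\<in>{K..<K + Suc j}. \<not> good k (block k (u @ v))) \<longleftrightarrow>
          \<not> good (K + j) v \<and> (\<forall>k\<in>{K..<K + j}. \<not> good k (block k u))"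
          using old new by simp
        then show ?thesis by simp
      qed
    qed
    also have "\<dots> = ?A j u * (1 - wexp ?N (\<lambda>v. of_bool (good (K + j) v)))"
      by (simp only: wexp_cmult wexp_diff wexp_const)
    also have "\<dots> \<le> ?A j u * (1 - c (K + j))"
      using c[of "K + j"] by (intro mult_left_mono) auto
    finally show "wexp ?N (\<lambda>v. ?A (Suc j) (u @ v)) \<le> (1 - c (K + j)) * ?A j u"
      by (simp add: mult.commute)
  qed
  also have "\<dots> \<le> (1 - c (K + j)) * (\<Prod>k\<in>{K..<K + j}. 1 - c k)"
    unfolding wexp_cmult using c1 Suc.IH by (intro mult_left_mono) auto
  finally show ?case by (simp add: mult_ac mult_2_right[symmetric])
qed simp

text \<open>The second Borel-Cantelli lemma: the probability of no good block from \<open>K\<close>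
  on is at most a product of factors \<open>1 - c k \<le> exp (- c k)\<close>, which tends to zero
  as the sum of the \<open>c k\<close> diverges.\<close>

lemma AE_infinitely_many_good_blocks:
  assumes c: "\<And>k. c k \<le> wexp (4 * 2 ^ k) (\<lambda>b. of_bool (good k b))"
    and nonneg: "\<And>k. 0 \<le> c k" and div: "\<not> summable c"
  shows "AE \<omega> in bern. \<forall>K. \<exists>k\<ge>K. good k (stake (4 * 2 ^ k) (sdrop (4 * 2 ^ k) \<omega>))"
proof -
  interpret prob_space bern by (rule prob_space_bern)
  let ?B = "\<lambda>k \<omega>. stake (4 * 2 ^ k) (sdrop (4 * 2 ^ k) \<omega>) :: 'a list"
  have block_stake: "block k (stake N \<omega>) = ?B k \<omega>" if "2 * (4 * 2 ^ k) \<le> N" for k N \<omega>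
  proof -
    have "take m (drop m (stake N \<omega>)) = stake m (sdrop m \<omega>)" if "2 * m \<le> N" for m
    proof -
      have "m \<le> N - m" using that by linarith
      then show ?thesis by (simp add: drop_stake take_stake min_def)
    qed
    then show ?thesis using that by (simp only: block_def)
  qed
  have "AE \<omega> in bern. \<exists>k\<ge>K. good k (?B k \<omega>)" for K
  proof -
    define Z where "Z j = {\<omega>. \<forall>k\<in>{K..<K + j}. \<not> good k (block k (stake (4 * 2 ^ (K + j)) \<omega>))}" for j
    have Z_eq: "Z j = {\<omega>. \<forall>k\<in>{K..<K + j}. \<not> good k (?B k \<omega>)}" for j
    proof -
      have "2 * (4 * 2 ^ k) \<le> 4 * (2 :: nat) ^ (K + j)" if "k < K + j" for k
        using that power_increasing[of "Suc k" "K + j" "2 :: nat"] by simp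
      then show ?thesis by (simp add: Z_def block_stake)
    qed
    have Z_sets: "Z j \<in> events" for j unfolding Z_def by (rule sets_stake)
    have "(\<Inter>j. Z j) \<in> events" using Z_sets by auto
    moreover have "prob (\<Inter>j. Z j) \<le> \<epsilon>" if "0 < \<epsilon>" for \<epsilon>
    proof -
      have "\<not> (\<forall>j. (\<Sum>k\<in>{K..<K + j}. c k) \<le> ln (1 / \<epsilon>))"
      proof
        assume *: "\<forall>j. (\<Sum>k\<in>{K..<K + j}. c k) \<le> ln (1 / \<epsilon>)"
        have "summable (\<lambda>j. c (j + K))"
        proof (rule summableI_nonneg_bounded)
          show "(\<Sum>i<n. c (i + K)) \<le> ln (1 / \<epsilon>)" for n
            using *[rule_format, of n] sum.shift_bounds_nat_ivl[of c 0 K n]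
            by (simp add: atLeast0LessThan add.commute)
        qed (rule nonneg)
        then show False using div by (simp add: summable_iff_shift)
      qed
      then obtain j where j: "ln (1 / \<epsilon>) < (\<Sum>k\<in>{K..<K + j}. c k)" by (auto simp: not_le)
      have "prob (\<Inter>j. Z j) \<le> prob (Z j)" using Z_sets by (intro finite_measure_mono) auto
      also have "\<dots> \<le> (\<Prod>k\<in>{K..<K + j}. 1 - c k)"
        unfolding Z_def by (subst measure_stake) (rule wexp_no_good_block[OF c])
      also have "\<dots> \<le> (\<Prod>k\<in>{K..<K + j}. exp (- c k))"
      proof (intro prod_mono conjI)
        show "0 \<le> 1 - c k" for k
          using c[of k] wexp_le_const[of "4 * 2 ^ k" "\<lambda>b. of_bool (good k b)" 1] by force
        show "1 - c k \<le> exp (- c k)" for k using exp_ge_add_one_self[of "- c k"] by simp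
      qed
      also have "\<dots> = exp (- (\<Sum>k\<in>{K..<K + j}. c k))" by (simp add: exp_sum sum_negf[symmetric])
      also have "\<dots> \<le> exp (- ln (1 / \<epsilon>))" using j by simp
      also have "\<dots> = \<epsilon>" using that by (simp add: ln_div)
      finally show ?thesis .
    qed
    then have "prob (\<Inter>j. Z j) = 0"
      by (meson field_le_epsilon measure_nonneg antisym add_0 linorder_not_less dense_ge)
    ultimately have "AE \<omega> in bern. \<omega> \<notin> (\<Inter>j. Z j)"
      by (intro AE_not_in) (simp add: null_sets_def emeasure_eq_measure)
    then show ?thesis
      by (rule AE_mp) (intro AE_I2, auto simp: Z_eq)
  qed
  then show ?thesis by (simp add: AE_all_countable)
qed

end

subsection \<open>Coding of the self-similar set\<close>

lemma diameter_similarity_image: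
  fixes f :: "'a::real_normed_vector \<Rightarrow> 'b::real_normed_vector"
  assumes "bounded S" "0 \<le> c" "\<And>x y. x \<in> S \<Longrightarrow> y \<in> S \<Longrightarrow> dist (f x) (f y) = c * dist x y"
  shows "diameter (f ` S) = c * diameter S"
proof (cases "S = {}")
  case False
  have le: "dist (f x) (f y) \<le> c * diameter S" if "x \<in> S" "y \<in> S" for x y
    using diameter_bounded_bound[OF assms(1) that] assms that by (simp add: mult_left_mono)
  have bdd: "bounded (f ` S)"
    using le False unfolding bounded_def by blast
  show ?thesis
  proof (rule antisym)
    show "diameter (f ` S) \<le> c * diameter S"
      using le False by (intro diameter_le) (auto simp: dist_norm)
    show "c * diameter S \<le> diameter (f ` S)"
    proof (cases "c = 0")
      case True
      then show ?thesis using diameter_ge_0[OF bdd] by simp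
    next
      case False
      then have "0 < c" using assms by simp
      have "diameter S \<le> diameter (f ` S) / c"
      proof (rule diameter_le)
        fix x y assume xy: "x \<in> S" "y \<in> S"
        then have "c * dist x y \<le> diameter (f ` S)"
          using diameter_bounded_bound[OF bdd, of "f x" "f y"] assms by auto
        then show "norm (x - y) \<le> diameter (f ` S) / c"
          using \<open>0 < c\<close> by (simp add: dist_norm field_simps)
      qed (use \<open>S \<noteq> {}\<close> in auto)
      then show ?thesis using \<open>0 < c\<close> by (simp add: field_simps)
    qed
  qed
qed (simp add: diameter_def)

locale integer_ifs =
  fixes P :: "'a::finite \<Rightarrow> int ^ 'd::finite" and q :: "'a \<Rightarrow> int"
  assumes q_ge: "2 \<le> \<bar>q a\<bar>"
begin

abbreviation "\<phi> \<equiv> ifs_map P q"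
abbreviation "\<pi> \<equiv> coding_map P q"
abbreviation "r \<equiv> contr_ratio q"

definition rw :: "'a list \<Rightarrow> real"
  where "rw w = prod_list (map r w)"

lemma rw_simps [simp]: "rw [] = 1" "rw (a # w) = r a * rw w" "rw (u @ v) = rw u * rw v"
  by (simp_all add: rw_def)

lemma r_pos: "0 < r a" and r_le: "r a \<le> 1 / 2"
  using q_ge[of a] by (auto simp: contr_ratio_def divide_simps)

lemma rw_pos: "0 < rw w"
  by (induction w) (auto simp: r_pos)

lemma rw_le: "rw w \<le> (1 / 2) ^ length w"
proof (induction w)
  case (Cons a w)
  then have "r a * rw w \<le> (1 / 2) * (1 / 2) ^ length w"
    using r_le rw_pos r_pos by (intro mult_mono) (auto intro: less_imp_le)
  then show ?case by simp
qed simp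

lemma dist_ifs_map: "dist (\<phi> a x) (\<phi> a y) = r a * dist x y"
proof -
  have "\<phi> a x - \<phi> a y = (1 / real_of_int (q a)) *\<^sub>R (x - y)"
    by (simp add: ifs_map_def algebra_simps)
  then show ?thesis by (simp add: dist_norm contr_ratio_def)
qed

lemma dist_foldr: "dist (foldr \<phi> w x) (foldr \<phi> w y) = rw w * dist x y"
  by (induction w) (auto simp: dist_ifs_map)

definition code_term :: "'a stream \<Rightarrow> nat \<Rightarrow> real ^ 'd"
  where "code_term \<omega> n = (1 / real_of_int (\<Prod>l\<le>n. q (\<omega> !! l))) *\<^sub>R int_vec (P (\<omega> !! n))"

lemma norm_code_term:
  "norm (code_term \<omega> n) \<le> (1 / 2) ^ n * (\<Sum>a\<in>UNIV. norm (int_vec (P a)))"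
proof -
  have "\<bar>1 / real_of_int (\<Prod>l\<le>n. q (\<omega> !! l))\<bar> = (\<Prod>l\<le>n. r (\<omega> !! l))"
    by (simp add: contr_ratio_def prod_dividef of_int_prod abs_prod)
  also have "\<dots> \<le> (\<Prod>l\<le>n. 1 / 2)"
    using r_pos r_le by (intro prod_mono) (auto intro: less_imp_le)
  also have "\<dots> \<le> (1 / 2) ^ n" by simp
  finally show ?thesis
    unfolding code_term_def norm_scaleR
    by (intro mult_mono member_le_sum) auto
qed

lemma summable_bound: "summable (\<lambda>n. (1 / 2) ^ n * (c :: real))"
  by (intro summable_mult2 summable_geometric) auto

lemma summable_code_term: "summable (code_term \<omega>)"
  by (rule summable_comparison_test'[OF summable_bound norm_code_term])

lemma coding_map_eq: "\<pi> \<omega> = (\<Sum>n. code_term \<omega> n)"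
  by (simp add: coding_map_def code_term_def)

lemma bounded_range_coding: "bounded (range \<pi>)"
proof (rule boundedI)
  fix x assume "x \<in> range \<pi>"
  then obtain \<omega> where x: "x = \<pi> \<omega>" by auto
  show "norm x \<le> (\<Sum>n. (1 / 2) ^ n * (\<Sum>a\<in>UNIV. norm (int_vec (P a))))"
  proof -
    have sn: "summable (\<lambda>n. norm (code_term \<omega> n))"
      by (rule summable_comparison_test'[OF summable_bound[of "\<Sum>a\<in>UNIV. norm (int_vec (P a))"], of 0])
        (simp add: norm_code_term)
    show ?thesis
      unfolding x coding_map_eq
      using summable_norm[OF sn] suminf_le[OF norm_code_term sn summable_bound] by linarith
  qed
qed

lemma coding_map_SCons: "\<pi> (a ## \<omega>) = \<phi> a (\<pi> \<omega>)"
proof -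
  have "code_term (a ## \<omega>) (Suc n) = (1 / real_of_int (q a)) *\<^sub>R code_term \<omega> n" for n
    unfolding code_term_def prod.atMost_Suc_shift by simp
  then have "\<pi> (a ## \<omega>) = (1 / real_of_int (q a)) *\<^sub>R \<pi> \<omega> + code_term (a ## \<omega>) 0"
    using suminf_split_head[OF summable_code_term, of "a ## \<omega>"]
      suminf_scaleR_right[OF summable_code_term, of "1 / real_of_int (q a)" \<omega>]
    by (simp add: coding_map_eq algebra_simps)
  then show ?thesis by (simp add: ifs_map_def code_term_def algebra_simps)
qed

lemma coding_map_shift: "\<pi> (w @- \<omega>) = foldr \<phi> w (\<pi> \<omega>)"
  by (induction w) (auto simp: coding_map_SCons)

text \<open>A composition of \<open>n\<close> maps shrinks a bounded set by a factor
  \<open>(1/2)^n\<close>, so the starting points are forgotten in the limit even if they vary with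
  \<open>n\<close>.\<close>

lemma foldr_approx_tendsto:
  assumes "bounded K" "\<And>n. y n \<in> K" "\<And>n. z n \<in> K"
  shows "(\<lambda>n. dist (foldr \<phi> (stake n \<omega>) (y n)) (foldr \<phi> (stake n \<omega>) (z n))) \<longlonglongrightarrow> 0"
proof (rule tendsto_sandwich[OF always_eventually always_eventually tendsto_const])
  show "\<forall>n. dist (foldr \<phi> (stake n \<omega>) (y n)) (foldr \<phi> (stake n \<omega>) (z n)) \<le> (1 / 2) ^ n * diameter K"
    unfolding dist_foldr
    using rw_le[of "stake _ \<omega>"] diameter_bounded_bound[OF assms(1)] assms rw_pos
    by (auto intro!: mult_mono)
  show "(\<lambda>n. (1 / 2) ^ n * diameter K) \<longlonglongrightarrow> 0"
    by (intro tendsto_mult_left_zero LIMSEQ_realpow_zero) auto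
qed auto

text \<open>Compositions applied to a point of \<open>K\<close> stay in \<open>K\<close> and
  converge to coded points, so \<open>K\<close> contains the range. Conversely, pulling a point of
  \<open>K\<close> back through the maps again and again reads off a coding of it.\<close>

lemma invariant_set_eq_range:
  assumes "K \<noteq> {}" "compact K" and inv: "K = (\<Union>a. \<phi> a ` K)"
  shows "K = range \<pi>"
proof
  have bdd: "bounded (K \<union> range \<pi>)"
    using assms bounded_range_coding by (simp add: compact_imp_bounded)
  show "range \<pi> \<subseteq> K"
  proof clarify
    fix \<omega>
    obtain k where "k \<in> K" using assms by auto
    have mem: "foldr \<phi> w k \<in> K" for w
    proof (induction w)
      case (Cons a w)
      then show ?case by (subst inv) auto
    qed (simp add: \<open>k \<in> K\<close>)
    have "(\<lambda>n. dist (foldr \<phi> (stake n \<omega>) k) (foldr \<phi> (stake n \<omega>) (\<pi> (sdrop n \<omega>)))) \<longlonglongrightarrow> 0"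
      by (rule foldr_approx_tendsto[OF bdd]) (use \<open>k \<in> K\<close> in auto)
    then have "(\<lambda>n. foldr \<phi> (stake n \<omega>) k) \<longlonglongrightarrow> \<pi> \<omega>"
      unfolding coding_map_shift[symmetric] stake_sdrop tendsto_dist_iff[symmetric] .
    then show "\<pi> \<omega> \<in> K"
      using mem compact_imp_closed[OF assms(2)] closed_sequentially by metis
  qed
  show "K \<subseteq> range \<pi>"
  proof
    fix x assume "x \<in> K"
    have "\<forall>x\<in>K. \<exists>a y. y \<in> K \<and> x = \<phi> a y"
      using equalityD1[OF inv] by blast
    \<comment> \<open>\<open>A x\<close> is a possible first letter of \<open>x\<close> and
      \<open>Y x\<close> the corresponding preimage; the letters of the coding are obtained by
      iterating \<open>Y\<close>.\<close>
    then obtain A Y where AY: "\<And>x. x \<in> K \<Longrightarrow> Y x \<in> K \<and> x = \<phi> (A x) (Y x)" by metis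
    have *: "z \<in> K \<Longrightarrow> (Y ^^ n) z \<in> K \<and> foldr \<phi> (stake n (smap A (siterate Y z))) ((Y ^^ n) z) = z" for n z
    proof (induction n arbitrary: z)
      case (Suc n)
      have "stake (Suc n) (smap A (siterate Y z)) = A z # stake n (smap A (siterate Y (Y z)))"
        by (simp only: stake.simps stream.map_sel siterate.simps)
      then show ?case
        using AY[OF Suc.prems] Suc.IH[of "Y z"] by (simp only: funpow_Suc_right o_apply foldr.simps)
    qed simp
    let ?\<omega> = "smap A (siterate Y x)"
    have "(\<lambda>n. dist (foldr \<phi> (stake n ?\<omega>) ((Y ^^ n) x)) (foldr \<phi> (stake n ?\<omega>) (\<pi> (sdrop n ?\<omega>)))) \<longlonglongrightarrow> 0"
      by (rule foldr_approx_tendsto[OF bdd]) (use *[OF \<open>x \<in> K\<close>] in auto)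
    then have "(\<lambda>n. dist x (\<pi> ?\<omega>)) \<longlonglongrightarrow> 0"
      using *[OF \<open>x \<in> K\<close>] unfolding coding_map_shift[symmetric] stake_sdrop by simp
    then have "x = \<pi> ?\<omega>" by (simp add: LIMSEQ_const_iff)
    then show "x \<in> range \<pi>" by blast
  qed
qed

lemma ifs_map_closure: "\<phi> a ` closure S = closure (\<phi> a ` S)"
proof -
  have "\<phi> a = (\<lambda>x. (1 / real_of_int (q a)) *\<^sub>R x) \<circ> (\<lambda>x. int_vec (P a) + x)"
    by (auto simp: ifs_map_def add.commute)
  then show ?thesis
    by (simp only: image_comp[symmetric] closure_translation[symmetric] closure_scaleR[symmetric])
qed

lemma range_coding_map: "(\<Union>a. \<phi> a ` range \<pi>) = range \<pi>"
proof (intro equalityI subsetI)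
  fix x assume "x \<in> range \<pi>"
  then obtain \<omega> where "x = \<pi> (shd \<omega> ## stl \<omega>)" by auto
  then show "x \<in> (\<Union>a. \<phi> a ` range \<pi>)" unfolding coding_map_SCons by blast
qed (auto simp flip: coding_map_SCons)

text \<open>The closure of the range is compact and invariant, hence equals the range by the
  uniqueness just shown. Compactness of the range thus comes without a topology on streams.\<close>

lemma self_similar_set_eq: "self_similar_set P q = range \<pi>"
  and compact_range: "compact (range \<pi>)"
proof -
  let ?K = "closure (range \<pi>)"
  have K: "compact ?K" using bounded_range_coding by (simp add: compact_closure)
  have inv: "?K = (\<Union>a. \<phi> a ` ?K)"
  proof -
    have "closure (\<Union>a\<in>A. \<phi> a ` range \<pi>) = (\<Union>a\<in>A. closure (\<phi> a ` range \<pi>))" for A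
      by (induction A rule: finite_induct[OF finite]) auto
    from this[of UNIV, unfolded range_coding_map] show ?thesis unfolding ifs_map_closure .
  qed
  have eq: "?K = range \<pi>" by (rule invariant_set_eq_range[OF _ K inv]) simp
  show "compact (range \<pi>)" using K eq by simp
  show "self_similar_set P q = range \<pi>"
    unfolding self_similar_set_def
  proof (rule the_equality)
    show "range \<pi> \<noteq> {} \<and> compact (range \<pi>) \<and> range \<pi> = (\<Union>a. \<phi> a ` range \<pi>)"
      using K eq range_coding_map by auto
  qed (use invariant_set_eq_range in blast)
qed

abbreviation "D \<equiv> diameter (range \<pi>)"

lemma diameter_cylinder: "diameter (cylinder P q w) = rw w * D"
  unfolding cylinder_def self_similar_set_eq
  using rw_pos[of w] by (intro diameter_similarity_image bounded_range_coding dist_foldr) auto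

lemma dist_coding_le: "dist (\<pi> (w @- \<omega>)) (\<pi> (w @- \<omega>')) \<le> rw w * D"
  unfolding coding_map_shift dist_foldr
  using rw_pos[of w] by (intro mult_left_mono diameter_bounded_bound bounded_range_coding) auto

lemma rational_points_ifs: "x \<in> rational_points \<Longrightarrow> \<phi> a x \<in> rational_points"
  by (auto simp: rational_points_def ifs_map_def int_vec_def)

lemma rational_points_foldr: "x \<in> rational_points \<Longrightarrow> foldr \<phi> w x \<in> rational_points"
  by (induction w) (auto intro: rational_points_ifs)

text \<open>Rational data make the fixed point of a composition rational. Only the absolute value of
  the slope is recorded, since the \<open>q a\<close> may be negative.\<close>

lemma foldr_affine:
  "\<exists>A\<in>\<rat>. \<exists>b\<in>rational_points. (\<forall>x. foldr \<phi> w x = A *\<^sub>R x + b) \<and> \<bar>A\<bar> = rw w"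
proof (induction w)
  case Nil
  show ?case by (rule bexI[of _ 1], rule bexI[of _ 0]) (auto simp: rational_points_def)
next
  case (Cons a w)
  then obtain A b where A: "A \<in> \<rat>" "b \<in> rational_points" "\<bar>A\<bar> = rw w"
    "\<And>x. foldr \<phi> w x = A *\<^sub>R x + b" by blast
  show ?case
  proof (rule bexI[of _ "A / real_of_int (q a)"], rule bexI[of _ "\<phi> a b"])
    show "(\<forall>x. foldr \<phi> (a # w) x = (A / real_of_int (q a)) *\<^sub>R x + \<phi> a b) \<and>
      \<bar>A / real_of_int (q a)\<bar> = rw (a # w)"
      using A(3) by (auto simp: A(4) ifs_map_def algebra_simps contr_ratio_def)
  qed (use A in \<open>auto intro: rational_points_ifs\<close>)
qed

text \<open>The image of \<open>cycle z\<close> is fixed by an affine map with rational data and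
  slope different from 1, so it solves a linear equation over the rationals.\<close>

lemma coding_map_eventually_periodic_rational:
  assumes "z \<noteq> []"
  shows "\<pi> (w @- cycle z) \<in> rational_points"
proof -
  obtain A b where A: "A \<in> \<rat>" "b \<in> rational_points" "\<bar>A\<bar> = rw z"
    "\<And>x. foldr \<phi> z x = A *\<^sub>R x + b" using foldr_affine[of z] by blast
  have "(1 / 2) ^ length z < (1 :: real)" using assms by (simp add: power_less_one_iff)
  then have "A \<noteq> 1" using A(3) rw_le[of z] by auto
  have "\<pi> (cycle z) = A *\<^sub>R \<pi> (cycle z) + b"
    using A(4) coding_map_shift[of z "cycle z"] cycle_decomp[OF assms] by metis
  then have "\<pi> (cycle z) $ i = A * \<pi> (cycle z) $ i + b $ i" for i
    by (metis vector_add_component vector_scaleR_component real_scaleR_def)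
  then have "\<pi> (cycle z) $ i = b $ i / (1 - A)" for i
    using \<open>A \<noteq> 1\<close> by (simp add: field_simps)
  then have "\<pi> (cycle z) \<in> rational_points"
    using A(1,2) by (auto simp: rational_points_def)
  then show ?thesis unfolding coding_map_shift by (rule rational_points_foldr)
qed

end

subsection \<open>The convergence case\<close>

text \<open>Premeasures are defined with covers indexed by the naturals. A countable cover is
  enumerated and padded with empty sets, whose gauge and diameter are zero.\<close>

lemma hausdorff_premeasure_le_countable:
  fixes V :: "'i \<Rightarrow> 'b::metric_space set"
  assumes "countable I" "E \<subseteq> (\<Union>z\<in>I. V z)" "0 \<le> \<delta>"
    and "\<And>z. z \<in> I \<Longrightarrow> bounded (V z) \<and> diameter (V z) \<le> \<delta>"
  shows "hausdorff_premeasure s \<delta> E \<le> (\<integral>\<^sup>+ z. hausdorff_gauge s (V z) \<partial>count_space I)"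
proof -
  let ?J = "to_nat_on I ` I"
  define U where "U i = (if i \<in> ?J then V (from_nat_into I i) else {})" for i
  have inv: "from_nat_into I (to_nat_on I z) = z" if "z \<in> I" for z
    using assms(1) that by simp
  have mem: "from_nat_into I i \<in> I" if "i \<in> ?J" for i
    using inv that by auto
  have cover: "E \<subseteq> (\<Union>i. U i)"
  proof
    fix x assume "x \<in> E"
    then obtain z where "z \<in> I" "x \<in> V z" using assms(2) by blast
    then have "x \<in> U (to_nat_on I z)" by (simp add: U_def inv)
    then show "x \<in> (\<Union>i. U i)" by blast
  qed
  have small: "bounded (U i) \<and> diameter (U i) \<le> \<delta>" for i
    using assms(3,4) mem[of i] by (simp add: U_def)
  have "hausdorff_premeasure s \<delta> E \<le> (\<Sum>i. hausdorff_gauge s (U i))"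
    unfolding hausdorff_premeasure_def using cover small by (intro INF_lower) auto
  also have "\<dots> = (\<integral>\<^sup>+ i. hausdorff_gauge s (U i) \<partial>count_space UNIV)"
    by (simp add: nn_integral_count_space_nat)
  also have "\<dots> = (\<integral>\<^sup>+ i. hausdorff_gauge s (V (from_nat_into I i)) * indicator ?J i \<partial>count_space UNIV)"
    by (intro nn_integral_cong) (auto simp: U_def hausdorff_gauge_def)
  also have "\<dots> = (\<integral>\<^sup>+ i. hausdorff_gauge s (V (from_nat_into I i)) \<partial>count_space ?J)"
    by (simp add: nn_integral_count_space_indicator)
  also have "\<dots> = (\<integral>\<^sup>+ z. hausdorff_gauge s (V (from_nat_into I (to_nat_on I z))) \<partial>count_space I)"
    using assms(1) by (intro nn_integral_bij_count_space[symmetric] inj_on_imp_bij_betw inj_on_to_nat_on)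
  also have "\<dots> = (\<integral>\<^sup>+ z. hausdorff_gauge s (V z) \<partial>count_space I)"
    by (intro nn_integral_cong) (simp add: inv)
  finally show ?thesis .
qed

context integer_ifs
begin

abbreviation "code_pt w l \<equiv> \<pi> (take l w @- cycle (drop l w))"

definition radius :: "(nat \<Rightarrow> real) \<Rightarrow> 'a list \<Rightarrow> real"
  where "radius g w = diameter (cylinder P q w) * g (length w)"

lemma radius_eq: "radius g w = rw w * D * g (length w)"
  by (simp add: radius_def diameter_cylinder)

lemma D_nonneg: "0 \<le> D"
  by (intro diameter_ge_0 bounded_range_coding)

lemma finite_pairs: "finite {(w :: 'a list, l). length w \<le> N \<and> l < length w}"
proof -
  have "finite {w :: 'a list. length w \<le> N}"
    using finite_lists_length_le[of "UNIV :: 'a set" N] by simp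
  then have "finite ({w :: 'a list. length w \<le> N} \<times> {..N})" by simp
  then show ?thesis by (rule rev_finite_subset) auto
qed

text \<open>Words of length at most \<open>N\<close> code only finitely many points, so some
  approximating point is coded by longer words only.\<close>

lemma well_approx_long_word:
  assumes "x \<in> well_approx_set P q g"
  obtains w l where "N < length w" "l < length w" "dist x (code_pt w l) < radius g w"
proof -
  let ?R = "{r \<in> self_similar_set P q \<inter> rational_points. ennreal (norm (x - r)) < Psi P q g r}"
  let ?S = "(\<lambda>(w, l). code_pt w l) ` {(w, l). length w \<le> N \<and> l < length w}"
  have "infinite ?R" "finite ?S"
    using assms finite_pairs by (auto simp: well_approx_set_def)
  then have "\<not> ?R \<subseteq> ?S" using finite_subset by blast
  then obtain r where r: "ennreal (norm (x - r)) < Psi P q g r" "r \<notin> ?S" by blast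
  then obtain w l where wl: "l < length w" "r = code_pt w l"
    "ennreal (norm (x - r)) < ennreal (radius g w)"
    by (auto simp: Psi_def less_SUP_iff radius_def)
  have "length w > N" using r(2) wl by force
  moreover have "dist x r < radius g w"
    using wl(3) by (simp add: dist_norm ennreal_less_iff)
  ultimately show ?thesis using that wl by blast
qed

text \<open>For every \<open>N\<close> the balls belonging to words longer than \<open>N\<close>
  cover the set, and their total gauge is at most \<open>2 powr s\<close> times a tail of the volume
  series.\<close>

theorem hausdorff_measure_well_approx_zero:
  assumes s: "0 \<le> s" and g: "\<And>n. 1 \<le> n \<Longrightarrow> 0 \<le> g n"
    and fin: "volume_series P q g s < \<infinity>"
  shows "hausdorff_measure s (well_approx_set P q g) = 0"
proof -
  let ?W = "well_approx_set P q g"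
  have rad_nonneg: "0 \<le> radius g w" if "w \<noteq> []" for w
    using that g[of "length w"] rw_pos[of w] D_nonneg by (cases w) (auto simp: radius_eq intro!: mult_nonneg_nonneg)
  define \<tau> where "\<tau> n = (\<Sum>w | length w = Suc n. real (Suc n) * radius g w powr s)" for n
  have \<tau>_nonneg: "0 \<le> \<tau> n" for n by (auto simp: \<tau>_def intro!: sum_nonneg)
  have "volume_series P q g s = (\<Sum>n. ennreal (\<tau> n))"
    unfolding volume_series_def \<tau>_def radius_def
    by (intro arg_cong[of _ _ suminf] ext) (auto simp: sum_ennreal intro!: sum.cong)
  then have summ: "summable \<tau>"
    using fin \<tau>_nonneg by (intro summable_suminf_not_top) auto
  have word_le: "real (Suc n) * radius g w powr s \<le> \<tau> n" if "length w = Suc n" for w n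
    unfolding \<tau>_def
    using finite_lists_length_eq[of "UNIV :: 'a set" "Suc n"] that by (intro member_le_sum) auto
  have bound: "hausdorff_premeasure s \<delta> ?W \<le> ennreal \<epsilon>" if "0 < \<delta>" "0 < \<epsilon>" for \<delta> \<epsilon>
  proof (cases "s = 0")
    \<comment> \<open>For counting measure no small cover helps. Since \<open>0 powr 0 = 0\<close>,
      every word of positive radius contributes at least 1 to the series, so convergence rules out
      long words of positive radius and the set is empty.\<close>
    case True
    have "\<tau> \<longlonglongrightarrow> 0" using summ by (rule summable_LIMSEQ_zero)
    then obtain N where N: "\<And>n. n \<ge> N \<Longrightarrow> \<tau> n < 1"
      using order_tendstoD(2)[of \<tau> 0 sequentially 1] by (auto simp: eventually_sequentially)
    have "?W = {}"
    proof (rule ccontr)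
      assume "?W \<noteq> {}"
      then obtain x where "x \<in> ?W" by auto
      then obtain w l where w: "Suc N < length w" "dist x (code_pt w l) < radius g w"
        using well_approx_long_word by metis
      then obtain n where n: "length w = Suc n" "N \<le> n" by (cases "length w") auto
      have "0 < radius g w" using w zero_le_dist le_less_trans by blast
      then have "real (Suc n) * 1 \<le> \<tau> n" using word_le[OF n(1)] True by (simp add: powr_def)
      then show False using N[OF n(2)] by simp
    qed
    then show ?thesis
      using hausdorff_premeasure_le_countable[of "{} :: nat set" ?W "\<lambda>_. {}" \<delta> s] that
      by (simp add: nn_integral_empty)
  next
    case False
    then have s: "0 < s" using s by simp
    \<comment> \<open>The first bound makes the total gauge at most \<open>\<epsilon>\<close> after
      the factor \<open>2 powr s\<close> from doubling radii; the second makes each single radius at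
      most \<open>\<delta> / 2\<close>.\<close>
    define \<eta> where "\<eta> = min (\<epsilon> / 2 powr s) ((\<delta> / 2) powr s)"
    have "0 < \<eta>" using that by (simp add: \<eta>_def)
    then obtain N where "norm (\<Sum>n. \<tau> (n + N)) < \<eta>"
      using suminf_exist_split[OF _ summ] by blast
    then have N: "(\<Sum>n. \<tau> (n + N)) \<le> \<eta>" by simp
    have summN: "summable (\<lambda>n. \<tau> (n + N))" using summ by (simp add: summable_iff_shift)
    define I where "I n = {(w :: 'a list, l). length w = Suc (n + N) \<and> l < length w}" for n
    have fin_I: "finite (I n)" for n
      by (rule finite_subset[OF _ finite_pairs[of "Suc (n + N)"]]) (auto simp: I_def)
    let ?V = "\<lambda>(w, l). ball (code_pt w l) (radius g w)"
    have small: "2 * radius g w \<le> \<delta>" if "(w, l) \<in> I n" for w l n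
    proof -
      have w: "length w = Suc (n + N)" using that by (simp add: I_def)
      then have "w \<noteq> []" by auto
      have "radius g w powr s \<le> real (Suc (n + N)) * radius g w powr s"
        by (simp add: mult_le_cancel_right1)
      also have "\<dots> \<le> \<tau> (n + N)" by (rule word_le[OF w])
      also have "\<dots> \<le> (\<Sum>n. \<tau> (n + N))"
        using sum_le_suminf[OF summN, of "{n}"] \<tau>_nonneg by simp
      also have "\<dots> \<le> (\<delta> / 2) powr s" using N by (simp add: \<eta>_def)
      finally have "radius g w \<le> \<delta> / 2"
        using powr_less_mono2[of s "\<delta> / 2" "radius g w"] s \<open>0 < \<delta>\<close> by linarith
      then show ?thesis by simp
    qed
    have rad_I: "0 \<le> radius g w" if "(w, l) \<in> I n" for w l n
      using that by (intro rad_nonneg) (auto simp: I_def)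
    have diam: "diameter (ball (code_pt w l) (radius g w)) = 2 * radius g w" if "(w, l) \<in> I n" for w l n
      using rad_I[OF that] by (simp add: diameter_ball)
    have "hausdorff_premeasure s \<delta> ?W \<le> (\<integral>\<^sup>+ z. hausdorff_gauge s (?V z) \<partial>count_space (\<Union>n. I n))"
    proof (rule hausdorff_premeasure_le_countable)
      show "countable (\<Union>n. I n)" using fin_I by (intro countable_UN) (auto intro: countable_finite)
      show "?W \<subseteq> (\<Union>z\<in>\<Union>n. I n. ?V z)"
      proof
        fix x assume "x \<in> ?W"
        then obtain w l where w: "N < length w" "l < length w" "dist x (code_pt w l) < radius g w"
          using well_approx_long_word by metis
        then have "(w, l) \<in> I (length w - Suc N)" by (auto simp: I_def)
        then show "x \<in> (\<Union>z\<in>\<Union>n. I n. ?V z)" using w(3) by (fastforce simp: dist_commute)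
      qed
    next
      show "bounded (?V z) \<and> diameter (?V z) \<le> \<delta>" if "z \<in> (\<Union>n. I n)" for z
        using that small \<open>0 < \<delta>\<close> by (cases z) (auto simp: diameter_ball)
    qed (use \<open>0 < \<delta>\<close> in auto)
    also have "\<dots> = (\<integral>\<^sup>+ z. (\<Sum>n. hausdorff_gauge s (?V z) * indicator (I n) z) \<partial>count_space UNIV)"
    proof -
      have disj: "disjoint_family I" by (auto simp: disjoint_family_on_def I_def)
      show ?thesis
        unfolding nn_integral_count_space_indicator[symmetric, of "\<Union>n. I n", simplified]
        by (subst nn_integral_count_space_indicator)
           (auto intro!: nn_integral_cong simp: ennreal_suminf_cmult suminf_indicator[OF disj])
    qed
    also have "\<dots> = (\<Sum>n. \<integral>\<^sup>+ z. hausdorff_gauge s (?V z) * indicator (I n) z \<partial>count_space UNIV)"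
      by (rule nn_integral_suminf) simp
    also have "\<dots> = (\<Sum>n. \<Sum>z\<in>I n. hausdorff_gauge s (?V z))"
      using fin_I by (simp flip: nn_integral_count_space_indicator add: nn_integral_count_space_finite)
    also have "\<dots> \<le> (\<Sum>n. ennreal (2 powr s * \<tau> (n + N)))"
    proof (intro suminf_le allI)
      fix n
      have "(\<Sum>z\<in>I n. hausdorff_gauge s (?V z)) \<le> (\<Sum>(w, l)\<in>I n. ennreal (2 powr s * radius g w powr s))"
        using s diam rad_I by (intro sum_mono) (auto simp: hausdorff_gauge_def powr_mult)
      also have "\<dots> = ennreal (\<Sum>(w, l)\<in>I n. 2 powr s * radius g w powr s)"
        by (subst sum_ennreal[symmetric]) (auto simp: case_prod_beta)
      \<comment> \<open>A word of length \<open>n\<close> has \<open>n\<close> possible starts of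
        the period, which is the factor \<open>n\<close> in the volume series.\<close>
      also have "(\<Sum>(w, l)\<in>I n. 2 powr s * radius g w powr s) = 2 powr s * \<tau> (n + N)"
      proof -
        have "I n = {w. length w = Suc (n + N)} \<times> {..n + N}" by (auto simp: I_def)
        then show ?thesis
          by (simp add: sum.cartesian_product[symmetric] \<tau>_def sum_distrib_left mult_ac)
      qed
      finally show "(\<Sum>z\<in>I n. hausdorff_gauge s (?V z)) \<le> ennreal (2 powr s * \<tau> (n + N))" .
    qed auto
    also have "\<dots> = ennreal (2 powr s * (\<Sum>n. \<tau> (n + N)))"
      using summN \<tau>_nonneg by (subst suminf_ennreal2) (auto simp: suminf_mult summable_mult)
    also have "\<dots> \<le> ennreal \<epsilon>"
    proof (rule ennreal_leI)
      have "(\<Sum>n. \<tau> (n + N)) \<le> \<epsilon> / 2 powr s" using N by (simp add: \<eta>_def)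
      then show "2 powr s * (\<Sum>n. \<tau> (n + N)) \<le> \<epsilon>" by (simp add: field_simps)
    qed
    finally show ?thesis .
  qed
  have "hausdorff_premeasure s \<delta> ?W \<le> 0" if "0 < \<delta>" for \<delta>
  proof (rule ennreal_le_epsilon)
    fix \<epsilon> :: real assume "0 < \<epsilon>"
    from bound[OF that this] show "hausdorff_premeasure s \<delta> ?W \<le> 0 + ennreal \<epsilon>"
      unfolding add_0_left .
  qed
  then show ?thesis unfolding hausdorff_measure_def by simp
qed

end

subsection \<open>The divergence case\<close>

text \<open>A subset of \<open>C\<close> is infinite iff it leaves every finite subset of
  \<open>C\<close>; as \<open>C\<close> is countable, this is a countable intersection of countable
  unions of balls.\<close>

lemma sets_infinitely_many_balls:
  fixes \<rho> :: "'b::{metric_space,second_countable_topology} \<Rightarrow> ennreal"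
  assumes "countable C" "S \<in> sets borel"
  shows "{x \<in> S. infinite {r \<in> C. ennreal (dist x r) < \<rho> r}} \<in> sets borel"
proof -
  have "infinite {r \<in> C. ennreal (dist x r) < \<rho> r} \<longleftrightarrow>
      (\<forall>F\<in>{F. finite F \<and> F \<subseteq> C}. \<exists>r\<in>C - F. ennreal (dist x r) < \<rho> r)" for x
  proof
    assume inf: "infinite {r \<in> C. ennreal (dist x r) < \<rho> r}"
    show "\<forall>F\<in>{F. finite F \<and> F \<subseteq> C}. \<exists>r\<in>C - F. ennreal (dist x r) < \<rho> r"
    proof
      fix F assume F: "F \<in> {F. finite F \<and> F \<subseteq> C}"
      then have "\<not> {r \<in> C. ennreal (dist x r) < \<rho> r} \<subseteq> F" using inf finite_subset by blast
      then show "\<exists>r\<in>C - F. ennreal (dist x r) < \<rho> r" by blast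
    qed
  next
    assume *: "\<forall>F\<in>{F. finite F \<and> F \<subseteq> C}. \<exists>r\<in>C - F. ennreal (dist x r) < \<rho> r"
    show "infinite {r \<in> C. ennreal (dist x r) < \<rho> r}"
    proof
      assume "finite {r \<in> C. ennreal (dist x r) < \<rho> r}"
      then show False using *[THEN bspec, of "{r \<in> C. ennreal (dist x r) < \<rho> r}"] by auto
    qed
  qed
  then have "{x \<in> S. infinite {r \<in> C. ennreal (dist x r) < \<rho> r}}
      = S \<inter> (\<Inter>F\<in>{F. finite F \<and> F \<subseteq> C}. \<Union>r\<in>C - F. {x. ennreal (dist x r) < \<rho> r})"
    by auto
  moreover have "{x. ennreal (dist x r) < \<rho> r} \<in> sets borel" for r
  proof -
    have "{x \<in> space borel. ennreal (dist x r) < \<rho> r} \<in> sets borel" by measurable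
    then show ?thesis by simp
  qed
  moreover have "countable {F. finite F \<and> F \<subseteq> C}"
    using assms(1) by (rule countable_Collect_finite_subset)
  moreover have "{F. finite F \<and> F \<subseteq> C} \<noteq> {}" by auto
  ultimately show ?thesis
    using assms by (auto intro!: sets.Int sets.countable_INT' sets.countable_UN' countable_Diff)
qed

lemma countable_rational_points: "countable (rational_points :: (real ^ 'd) set)"
proof -
  have "(rational_points :: (real ^ 'd) set) \<subseteq> (\<lambda>f. \<chi> i. f i) ` (PiE UNIV (\<lambda>_. \<rat>))"
  proof
    fix x :: "real ^ 'd" assume "x \<in> rational_points"
    then have "x = (\<chi> i. (($) x) i)" "(($) x) \<in> PiE UNIV (\<lambda>_. \<rat>)"
      by (auto simp: rational_points_def)
    then show "x \<in> (\<lambda>f. \<chi> i. f i) ` (PiE UNIV (\<lambda>_. \<rat>))" by blast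
  qed
  moreover have "countable (PiE (UNIV :: 'd set) (\<lambda>_. \<rat> :: real set))"
    by (intro countable_PiE) (auto simp: countable_rat)
  ultimately show ?thesis by (meson countable_image countable_subset)
qed

section \<open>Periodic approximants and the similarity dimension\<close>

context integer_ifs
begin

lemma well_approx_set_borel: "well_approx_set P q g \<in> sets borel"
  unfolding well_approx_set_def dist_norm[symmetric]
  using countable_rational_points compact_range
  by (intro sets_infinitely_many_balls) (auto simp: self_similar_set_eq intro: borel_compact)

lemma Psi_ge: "l < length w \<Longrightarrow> ennreal (radius g w) \<le> Psi P q g (code_pt w l)"
  unfolding Psi_def radius_def by (rule SUP_upper2[of "(w, l)"]) auto

lemma code_pt_rational: "l < length w \<Longrightarrow> code_pt w l \<in> self_similar_set P q \<inter> rational_points"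
  by (auto simp: self_similar_set_eq coding_map_eventually_periodic_rational)

text \<open>The period, restarted at position \<open>N\<close>, begins with the word of length
  \<open>h\<close> at \<open>l\<close>, which by \<open>l + h \<le> N\<close> lies within one
  period. So both codings share their first \<open>N + h\<close> letters.\<close>

lemma dist_code_pt:
  assumes "l < N" "l + h \<le> N" "stake h (sdrop l \<omega>) = stake h (sdrop N \<omega>)"
  shows "dist (\<pi> \<omega>) (code_pt (stake N \<omega>) l) \<le> rw (stake N \<omega>) * rw (stake h (sdrop N \<omega>)) * D"
proof -
  let ?w = "stake N \<omega>" and ?u = "stake h (sdrop N \<omega>)"
  have drop: "drop l ?w = stake (N - l) (sdrop l \<omega>)" by (simp add: drop_stake)
  also have "\<dots> = stake h (sdrop l \<omega>) @ stake (N - l - h) (sdrop h (sdrop l \<omega>))"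
    using assms(2) by (subst stake_add) simp
  finally obtain v where v: "drop l ?w = ?u @ v" using assms(3) by metis
  have "drop l ?w \<noteq> []" using assms(1) by simp
  then have cyc: "cycle (drop l ?w) = ?u @- v @- cycle (drop l ?w)"
    using cycle_decomp[of "drop l ?w"] v by (metis shift_append)
  have "take l ?w @- cycle (drop l ?w) = take l ?w @- drop l ?w @- cycle (drop l ?w)"
    using cycle_decomp[OF \<open>drop l ?w \<noteq> []\<close>] by metis
  also have "\<dots> = ?w @- cycle (drop l ?w)" by (simp flip: shift_append)
  also have "\<dots> = (?w @ ?u) @- v @- cycle (drop l ?w)" by (subst cyc) (simp only: shift_append)
  finally have code: "code_pt ?w l = \<pi> ((?w @ ?u) @- v @- cycle (drop l ?w))" by (rule arg_cong)
  have \<omega>: "\<omega> = (?w @ ?u) @- sdrop h (sdrop N \<omega>)"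
    by (simp add: stake_sdrop)
  have "dist (\<pi> \<omega>) (code_pt ?w l)
      = dist (\<pi> ((?w @ ?u) @- sdrop h (sdrop N \<omega>))) (\<pi> ((?w @ ?u) @- v @- cycle (drop l ?w)))"
    by (rule arg_cong2[OF arg_cong[OF \<omega>] code])
  also have "\<dots> \<le> rw (?w @ ?u) * D" by (rule dist_coding_le)
  finally show ?thesis by (simp only: rw_simps)
qed

text \<open>The sum is strictly decreasing in \<open>s\<close>, equals the number \<open>n\<close>
  of letters at \<open>s = 0\<close>, and is at most \<open>n / 2^n \<le> 1\<close> at
  \<open>s = n\<close>; the intermediate value theorem applies. Two letters exclude the solution
  \<open>s = 0\<close>.\<close>

lemma sim_dim_exists:
  assumes "(a :: 'a) \<noteq> b"
  shows "0 < sim_dim q" "(\<Sum>a\<in>UNIV. r a powr sim_dim q) = 1"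
proof -
  let ?f = "\<lambda>s. \<Sum>a\<in>UNIV. r a powr s"
  let ?n = "real CARD('a)"
  have card: "2 \<le> CARD('a)"
    using card_mono[of "UNIV :: 'a set" "{a, b}"] assms by simp
  have r1: "r c < 1" for c using r_le[of c] by simp
  have "?f ?n \<le> 1"
  proof -
    have "?f ?n \<le> (\<Sum>a\<in>(UNIV :: 'a set). (1 / 2) ^ CARD('a))"
    proof (intro sum_mono)
      fix c
      have "r c powr ?n = r c ^ CARD('a)" using r_pos by (simp add: powr_realpow)
      also have "\<dots> \<le> (1 / 2) ^ CARD('a)" using r_pos[of c] r_le by (intro power_mono) auto
      finally show "r c powr ?n \<le> (1 / 2) ^ CARD('a)" .
    qed
    also have "\<dots> = real CARD('a) / 2 ^ CARD('a)" by (simp add: power_one_over)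
    also have "\<dots> \<le> 1"
    proof -
      have "CARD('a) < 2 ^ CARD('a)" by (rule less_exp)
      then have "real CARD('a) \<le> 2 ^ CARD('a)" by (metis less_imp_le of_nat_less_numeral_power_cancel_iff)
      then show ?thesis by simp
    qed
    finally show ?thesis .
  qed
  moreover have "1 \<le> ?f 0" using card r_pos by (simp add: powr_zero_eq_one less_imp_neq[symmetric])
  moreover have "continuous_on {0..?n} ?f"
    using r_pos by (intro continuous_intros) (auto simp: less_imp_neq[symmetric])
  ultimately obtain s where s: "0 \<le> s" "?f s = 1"
    using IVT2'[of ?f ?n 1 0] by auto
  have anti: "?f t < ?f u" if "u < t" for t u
    using that r1 r_pos by (intro sum_strict_mono) (auto intro: powr_less_mono')
  have uniq: "s' = s" if "?f s' = 1" for s'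
    using anti[of s s'] anti[of s' s] that s by (cases s s' rule: linorder_cases) auto
  have "sim_dim q = s" unfolding sim_dim_def by (rule the_equality, rule s(2), rule uniq)
  moreover have "s \<noteq> 0"
  proof
    assume "s = 0"
    then have "?f s = real CARD('a)" using r_pos by (simp add: less_imp_neq[symmetric])
    then show False using s card by simp
  qed
  ultimately show "0 < sim_dim q" "?f (sim_dim q) = 1" using s by auto
qed

end

section \<open>Systems whose attractor is more than a point\<close>

locale nontrivial_ifs = integer_ifs +
  assumes D_pos: "0 < diameter (range (coding_map P q))"
begin

text \<open>Over a single letter there is only one sequence, and the attractor would have diameter
  zero.\<close>

lemma two_letters: obtains a b :: 'a where "a \<noteq> b"
proof -
  have "\<exists>a b :: 'a. a \<noteq> b"
  proof (rule ccontr)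
    assume "\<not> ?thesis"
    then have "\<omega> = \<omega>'" for \<omega> \<omega>' :: "'a stream"
      by (intro stream.coinduct[of "\<lambda>_ _. True"]) auto
    then have "\<pi> \<omega> = \<pi> \<omega>'" for \<omega> \<omega>' by metis
    then have "D \<le> 0" by (intro diameter_le) auto
    then show False using D_pos by simp
  qed
  then show ?thesis using that by blast
qed

lemma sim_dim_pos: "0 < sim_dim q"
  using two_letters sim_dim_exists by metis

abbreviation "pw \<equiv> prob_weight q"

sublocale letter_weights pw
proof
  show "0 < pw a" for a using r_pos[of a] by (simp add: prob_weight_def)
  show "(\<Sum>a\<in>UNIV. pw a) = 1"
    unfolding prob_weight_def using two_letters sim_dim_exists(2) by metis
qed

sublocale bounded_letter_weights pw "Min (range pw)" "Max (range pw)"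
proof
  have "Min (range pw) \<in> range pw" by (intro Min_in) auto
  then show "0 < Min (range pw)" using p_pos by auto
  have "Max (range pw) \<in> range pw" by (intro Max_in) auto
  then obtain a where a: "Max (range pw) = pw a" by (rule rangeE)
  obtain b where "b \<noteq> a" using two_letters by metis
  then have "pw a + pw b \<le> 1"
    using sum_mono2[of UNIV "{a, b}" pw] p_sum p_pos less_imp_le by auto
  then show "Max (range pw) < 1" using a p_pos[of b] by simp
qed auto

lemma bern_eq: "bernoulli_measure q = bern"
  by (simp add: bernoulli_measure_def bern_def)

text \<open>This translates thresholds for Bernoulli weights into thresholds for contraction
  ratios.\<close>

lemma wt_eq_rw_powr: "wt w = rw w powr sim_dim q"
  using rw_pos by (induction w) (auto simp: prob_weight_def powr_mult less_imp_le)

text \<open>The coding map is a pointwise limit of functions of finitely many letters.\<close>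

lemma measurable_coding_map [measurable]: "\<pi> \<in> borel_measurable bern"
proof (rule borel_measurable_LIMSEQ_metric)
  let ?\<omega> = "sconst undefined :: 'a stream"
  show "(\<lambda>\<omega>. foldr \<phi> (stake n \<omega>) (\<pi> ?\<omega>)) \<in> borel_measurable bern" for n
  proof -
    have "(\<lambda>\<omega>. foldr \<phi> (stake n \<omega>) (\<pi> ?\<omega>)) \<in> borel_measurable (stream_space (count_space UNIV))"
      by (rule measurable_compose[OF measurable_stake]) simp
    then show ?thesis by (simp cong: measurable_cong_sets add: sets_bern)
  qed
  show "(\<lambda>n. foldr \<phi> (stake n \<omega>) (\<pi> ?\<omega>)) \<longlonglongrightarrow> \<pi> \<omega>" for \<omega>
  proof -
    have "(\<lambda>n. dist (foldr \<phi> (stake n \<omega>) (\<pi> ?\<omega>)) (foldr \<phi> (stake n \<omega>) (\<pi> (sdrop n \<omega>)))) \<longlonglongrightarrow> 0"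
      by (rule foldr_approx_tendsto[OF bounded_range_coding]) auto
    then show ?thesis
      unfolding coding_map_shift[symmetric] stake_sdrop tendsto_dist_iff[symmetric] .
  qed
qed

lemma fibre_events: "{\<omega>. \<pi> \<omega> = x} \<in> sets bern"
proof -
  have "{\<omega> \<in> space bern. \<pi> \<omega> = x} \<in> sets bern" by measurable
  then show ?thesis by simp
qed

text \<open>If \<open>\<alpha>\<close> is the supremum of the masses of points, then a level \<open>n\<close> at which two cylinders are
  disjoint gives \<open>\<alpha> \<le> (1 - c) \<alpha>\<close> with \<open>c > 0\<close>: each point misses one of the two cylinders.\<close>

lemma fibre_null: "measure bern {\<omega>. \<pi> \<omega> = x} = 0"
proof -
  interpret prob_space bern by (rule prob_space_bern)
  let ?m = "\<lambda>x. prob {\<omega>. \<pi> \<omega> = x}"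
  define \<alpha> where "\<alpha> = (SUP x. ?m x)"
  have bdd: "bdd_above (range ?m)" by (intro bdd_aboveI[of _ 1]) auto
  have le_\<alpha>: "?m x \<le> \<alpha>" for x unfolding \<alpha>_def by (intro cSUP_upper bdd) auto
  have \<alpha>_nonneg: "0 \<le> \<alpha>" using le_\<alpha>[of undefined] measure_nonneg order.trans by blast
  have "\<exists>\<omega>\<^sub>1 \<omega>\<^sub>2. \<pi> \<omega>\<^sub>1 \<noteq> \<pi> \<omega>\<^sub>2"
  proof (rule ccontr)
    assume "\<not> ?thesis"
    then have "D \<le> 0" by (intro diameter_le) auto
    then show False using D_pos by simp
  qed
  then obtain \<omega>\<^sub>1 \<omega>\<^sub>2 where ne: "\<pi> \<omega>\<^sub>1 \<noteq> \<pi> \<omega>\<^sub>2" by blast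
  define d where "d = dist (\<pi> \<omega>\<^sub>1) (\<pi> \<omega>\<^sub>2)"
  \<comment> \<open>At this level every cylinder has diameter below \<open>d / 2\<close>, so those
    of two points at distance \<open>d\<close> are disjoint.\<close>
  obtain n where n: "(1 / 2) ^ n < d / (2 * D)"
    using real_arch_pow_inv[of "d / (2 * D)" "1 / 2"] ne D_pos by (auto simp: d_def)
  define u v where "u = stake n \<omega>\<^sub>1" and "v = stake n \<omega>\<^sub>2"
  have near: "dist (\<pi> \<omega>) (foldr \<phi> (stake n \<omega>) (\<pi> \<omega>')) < d / 2" for \<omega> \<omega>'
  proof -
    have "dist (\<pi> \<omega>) (foldr \<phi> (stake n \<omega>) (\<pi> \<omega>')) \<le> rw (stake n \<omega>) * D"
      using dist_coding_le[of "stake n \<omega>" "sdrop n \<omega>" \<omega>'] by (simp add: stake_sdrop coding_map_shift)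
    also have "\<dots> \<le> (1 / 2) ^ n * D" using rw_le[of "stake n \<omega>"] D_pos by simp
    also have "\<dots> < d / 2" using n D_pos by (simp add: field_simps)
    finally show ?thesis .
  qed
  have disj: "foldr \<phi> u (\<pi> \<omega>) \<noteq> foldr \<phi> v (\<pi> \<omega>')" for \<omega> \<omega>'
  proof
    assume eq: "foldr \<phi> u (\<pi> \<omega>) = foldr \<phi> v (\<pi> \<omega>')"
    have "d \<le> dist (\<pi> \<omega>\<^sub>1) (foldr \<phi> u (\<pi> \<omega>)) + dist (\<pi> \<omega>\<^sub>2) (foldr \<phi> u (\<pi> \<omega>))"
      unfolding d_def by (rule dist_triangle2)
    also have "\<dots> < d / 2 + d / 2"
      using near[of \<omega>\<^sub>1 \<omega>] near[of \<omega>\<^sub>2 \<omega>'] eq by (simp add: u_def v_def)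
    finally show False by simp
  qed
  define c where "c = min (wt u) (wt v)"
  have "0 < c" using wt_pos by (simp add: c_def)
  have "?m x \<le> (1 - c) * \<alpha>" for x
  proof -
    \<comment> \<open>A composition of the maps is injective, so this event is a fibre of
      \<open>\<pi>\<close> over a single point, or empty.\<close>
    have img_le: "prob {\<omega>. foldr \<phi> w (\<pi> \<omega>) = x} \<le> \<alpha>" for w
    proof (cases "\<exists>\<omega>. foldr \<phi> w (\<pi> \<omega>) = x")
      case True
      then obtain \<omega>\<^sub>0 where \<omega>0: "foldr \<phi> w (\<pi> \<omega>\<^sub>0) = x" by blast
      have "foldr \<phi> w (\<pi> \<omega>) = x \<longleftrightarrow> \<pi> \<omega> = \<pi> \<omega>\<^sub>0" for \<omega>
        using dist_foldr[of w "\<pi> \<omega>" "\<pi> \<omega>\<^sub>0"] rw_pos[of w] \<omega>0 by auto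
      then show ?thesis using le_\<alpha> by simp
    qed (simp add: \<alpha>_nonneg)
    have "(\<forall>\<omega>. foldr \<phi> u (\<pi> \<omega>) \<noteq> x) \<or> (\<forall>\<omega>. foldr \<phi> v (\<pi> \<omega>) \<noteq> x)"
      using disj by metis
    then obtain z where z: "z = u \<or> z = v" "\<And>\<omega>. foldr \<phi> z (\<pi> \<omega>) \<noteq> x" by blast
    then have lz: "length z = n" by (auto simp: u_def v_def)
    have "?m x = wexp n (\<lambda>w. prob {\<omega>. foldr \<phi> w (\<pi> \<omega>) = x})"
      using measure_bern_shift[OF fibre_events[of x], of n] by (simp add: coding_map_shift)
    also have "\<dots> \<le> wexp n (\<lambda>w. \<alpha> * (1 - of_bool (prefix z w)))"
    proof (rule wexp_mono)
      fix w :: "'a list" assume "length w = n"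
      then have "prefix z w \<Longrightarrow> w = z" using lz by (auto elim!: prefixE)
      then show "prob {\<omega>. foldr \<phi> w (\<pi> \<omega>) = x} \<le> \<alpha> * (1 - of_bool (prefix z w))"
        using img_le[of w] z(2) by (cases "prefix z w") auto
    qed
    also have "\<dots> = \<alpha> * (1 - wt z)"
      using lz by (simp only: wexp_cmult wexp_diff wexp_const wexp_prefix)
    also have "\<dots> \<le> \<alpha> * (1 - c)"
      using z(1) \<alpha>_nonneg by (intro mult_left_mono) (auto simp: c_def)
    finally show ?thesis by (simp add: mult.commute)
  qed
  then have "\<alpha> \<le> (1 - c) * \<alpha>" unfolding \<alpha>_def by (intro cSUP_least) auto
  then have "c * \<alpha> \<le> 0" by (simp add: algebra_simps)
  then have "\<alpha> \<le> 0" using \<open>0 < c\<close> by (simp add: mult_le_0_iff)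
  then show ?thesis using le_\<alpha>[of x] measure_nonneg[of bern "{\<omega>. \<pi> \<omega> = x}"] by linarith
qed

lemma AE_irrational: "AE \<omega> in bern. \<pi> \<omega> \<notin> rational_points"
proof -
  interpret prob_space bern by (rule prob_space_bern)
  have "AE \<omega> in bern. \<pi> \<omega> \<noteq> x" for x
  proof -
    have "{\<omega>. \<pi> \<omega> = x} \<in> null_sets bern"
      using fibre_events fibre_null by (simp add: null_sets_def emeasure_eq_measure)
    from AE_not_in[OF this] show ?thesis by simp
  qed
  then have "AE \<omega> in bern. \<forall>x\<in>rational_points. \<pi> \<omega> \<noteq> x"
    by (simp add: AE_ball_countable countable_rational_points)
  then show ?thesis by eventually_elim blast
qed

text \<open>Infinitely many words might give the same few points. An irrational image has positive
  distance from any finite set of rational points, whereas the given approximations come arbitrarily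
  close.\<close>

lemma well_approxI:
  assumes irr: "\<pi> \<omega> \<notin> rational_points"
    and approx: "\<And>N\<^sub>0. \<exists>N l. N\<^sub>0 \<le> N \<and> l < N \<and> dist (\<pi> \<omega>) (code_pt (stake N \<omega>) l) < radius g (stake N \<omega>)
      \<and> dist (\<pi> \<omega>) (code_pt (stake N \<omega>) l) \<le> (1 / 2) ^ N * D"
  shows "\<pi> \<omega> \<in> well_approx_set P q g"
proof -
  let ?R = "{r \<in> self_similar_set P q \<inter> rational_points. ennreal (norm (\<pi> \<omega> - r)) < Psi P q g r}"
  have "infinite ?R"
  proof
    assume fin: "finite ?R"
    \<comment> \<open>The extra 1 keeps the minimum meaningful if there is no approximating point at
      all.\<close>
    define \<epsilon> where "\<epsilon> = Min (insert 1 ((\<lambda>r. dist (\<pi> \<omega>) r) ` ?R))"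
    have "0 < \<epsilon>" unfolding \<epsilon>_def using fin irr by (subst Min_gr_iff) auto
    then obtain N\<^sub>0 where N0: "(1 / 2) ^ N\<^sub>0 < \<epsilon> / D"
      using real_arch_pow_inv[of "\<epsilon> / D" "1 / 2"] D_pos by auto
    obtain N l where Nl: "N\<^sub>0 \<le> N" "l < N" "dist (\<pi> \<omega>) (code_pt (stake N \<omega>) l) < radius g (stake N \<omega>)"
      "dist (\<pi> \<omega>) (code_pt (stake N \<omega>) l) \<le> (1 / 2) ^ N * D"
      using approx by blast
    let ?r = "code_pt (stake N \<omega>) l"
    have "ennreal (norm (\<pi> \<omega> - ?r)) < ennreal (radius g (stake N \<omega>))"
      using Nl(3) by (simp add: dist_norm ennreal_less_iff)
    also have "\<dots> \<le> Psi P q g ?r" using Nl(2) by (intro Psi_ge) simp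
    finally have "?r \<in> ?R" using code_pt_rational[of l "stake N \<omega>"] Nl(2) by simp
    then have "\<epsilon> \<le> dist (\<pi> \<omega>) ?r" unfolding \<epsilon>_def using fin by (intro Min_le) auto
    also have "\<dots> \<le> (1 / 2) ^ N * D" by (rule Nl)
    also have "\<dots> \<le> (1 / 2) ^ N\<^sub>0 * D"
      using Nl(1) D_pos by (intro mult_right_mono power_decreasing) auto
    also have "\<dots> < \<epsilon>" using N0 D_pos by (simp add: field_simps)
    finally show False by simp
  qed
  then show ?thesis by (simp add: well_approx_set_def self_similar_set_eq)
qed

end

lemma prefix_stake:
  assumes "prefix u (stake j \<omega>)"
  shows "u = stake (length u) \<omega>" "length u \<le> j"
proof -
  show le: "length u \<le> j" using prefix_length_le[OF assms] by simp
  have "u = take (length u) (stake j \<omega>)" using assms by (auto elim!: prefixE)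
  then show "u = stake (length u) \<omega>" using le by (simp add: take_stake min_def split: if_splits)
qed

context letter_weights
begin

lemma sum_wt: "(\<Sum>w | length w = n. wt w) = 1"
proof (induction n)
  case (Suc n)
  have "(\<Sum>w | length w = Suc n. wt w) = (\<Sum>(a, w)\<in>UNIV \<times> {w. length w = n}. p a * wt w)"
    by (intro sum.reindex_bij_witness[of _ "\<lambda>(a, w). a # w" "\<lambda>w. (hd w, tl w)"])
       (auto simp: length_Suc_conv)
  also have "\<dots> = (\<Sum>a\<in>UNIV. p a) * (\<Sum>w | length w = n. wt w)"
    by (simp add: sum_product sum.cartesian_product)
  finally show ?case using Suc p_sum by simp
qed simp

end

section \<open>Full measure from divergence\<close>

context nontrivial_ifs
begin

text \<open>The weights of the words of each length add up to 1, so up to the constant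
  \<open>D powr sim_dim q\<close> the volume series is the sum of
  \<open>n * g n powr sim_dim q\<close>.\<close>

lemma not_summable_of_volume_series:
  assumes g: "\<And>n. 1 \<le> n \<Longrightarrow> 0 \<le> g n" and inf: "volume_series P q g (sim_dim q) = \<infinity>"
  shows "\<not> summable (\<lambda>n. real (Suc n) * g (Suc n) powr sim_dim q)"
proof
  let ?s = "sim_dim q"
  let ?f = "\<lambda>n. real (Suc n) * g (Suc n) powr ?s"
  assume "summable ?f"
  then have summ: "summable (\<lambda>n. D powr ?s * ?f n)" by (rule summable_mult)
  have "(\<Sum>w | length w = Suc n. ennreal (real (Suc n) * (diameter (cylinder P q w) * g (Suc n)) powr ?s))
      = ennreal (D powr ?s * ?f n)" for n
  proof -
    have "(\<Sum>w | length w = Suc n. real (Suc n) * (diameter (cylinder P q w) * g (Suc n)) powr ?s)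
        = (\<Sum>w | length w = Suc n. wt w * (D powr ?s * ?f n))"
    proof (rule sum.cong[OF refl])
      fix w :: "'a list"
      have "(diameter (cylinder P q w) * g (Suc n)) powr ?s = wt w * D powr ?s * g (Suc n) powr ?s"
        using rw_pos[of w] D_pos g[of "Suc n"]
        by (simp add: diameter_cylinder powr_mult wt_eq_rw_powr)
      then show "real (Suc n) * (diameter (cylinder P q w) * g (Suc n)) powr ?s = wt w * (D powr ?s * ?f n)"
        by (simp only: mult_ac)
    qed
    also have "\<dots> = D powr ?s * ?f n"
      unfolding sum_distrib_right[symmetric] sum_wt by simp
    finally show ?thesis by (subst sum_ennreal) auto
  qed
  then have "volume_series P q g ?s = (\<Sum>n. ennreal (D powr ?s * ?f n))"
    by (simp add: volume_series_def)
  also have "\<dots> = ennreal (\<Sum>n. D powr ?s * ?f n)"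
    using summ by (intro suminf_ennreal2) auto
  finally show False using inf by simp
qed

theorem emeasure_well_approx:
  assumes g: "\<And>n. 1 \<le> n \<Longrightarrow> 0 \<le> g n" and anti: "antimono_on {1..} g"
    and inf: "volume_series P q g (sim_dim q) = \<infinity>"
  shows "emeasure (self_similar_measure P q) (well_approx_set P q g) = 1"
proof -
  interpret prob_space bern by (rule prob_space_bern)
  define s where "s = sim_dim q"
  have s: "0 < s" using sim_dim_pos by (simp add: s_def)
  define G where "G n = g n powr s" for n
  have g_mono: "g j \<le> g i" if "1 \<le> i" "i \<le> j" for i j
    using anti that by (auto simp: monotone_on_def)
  have G_mono: "G j \<le> G i" if "1 \<le> i" "i \<le> j" for i j
    using that g[of j] g_mono s by (auto simp: G_def intro!: powr_mono2)
  define \<rho> where "\<rho> = Max (range pw)"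
  define a where "a = Min (range pw)"
  define C where "C = a\<^sup>2 / (5 + 2 / (1 - \<rho>))"
  have a_pos: "0 < a" and \<rho>_less: "\<rho> < 1" and \<rho>_gr: "0 < \<rho>"
    unfolding a_def \<rho>_def by (rule pmin(1), rule \<rho>(1), rule \<rho>_pos)
  then have "0 < C" by (auto simp: C_def intro!: divide_pos_pos add_pos_pos)
  \<comment> \<open>The index \<open>2^(k+3)\<close> is the end of block \<open>k\<close>, so by
    monotonicity \<open>g\<close> there is at most \<open>g\<close> at any position of the block.
    The half leaves room for a strict inequality, and the cap \<open>(1/4)^k\<close> ensures
    \<open>M * M * t \<le> 1\<close> for \<open>M = 2^k\<close>.\<close>
  define t where "t k = min (G (2 ^ (k + 3)) / 2) ((1 / 4) ^ k)" for k
  obtain k' where k': "\<And>k t. k' \<le> k \<Longrightarrow> (1 / 8) ^ k \<le> t \<Longrightarrow> t \<le> (1 / 4) ^ k \<Longrightarrow>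
    (\<exists>R m. \<rho> ^ R \<le> t \<and> t \<le> a ^ m \<and> R \<le> 2 ^ k \<and> real R * real R * \<rho> ^ m \<le> 1)"
    using eventually_stopping_parameters[OF a_pos \<rho>_gr \<rho>_less] by metis
  define k\<^sub>0 where "k\<^sub>0 = max 1 k'"
  \<comment> \<open>Thresholds below \<open>(1/8)^k\<close> are discarded, so that stopped words
    have length of order \<open>k\<close> and fit into the block.\<close>
  define adm where "adm k \<longleftrightarrow> k\<^sub>0 \<le> k \<and> (1 / 8) ^ k \<le> t k" for k
  define c where "c k = (if k\<^sub>0 \<le> k \<and> (1 / 8) ^ k \<le> t k then C * (4 ^ k * t k) else 0)" for k
  \<comment> \<open>The two halves of the block, each of length \<open>2 * 2^k\<close>, play the
    roles of the independent words \<open>x\<close> and \<open>y\<close>.\<close>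
  define good where "good k b \<longleftrightarrow> adm k \<and> (\<exists>l<2 ^ k. \<exists>n<2 ^ k.
    hit (t k) (take (2 * 2 ^ k) b) (drop (2 * 2 ^ k) b) l n)" for k b
  have adm: "0 < t k" "t k < 1" "t k \<le> (1 / 4) ^ k"
    "\<exists>R m. \<rho> ^ R \<le> t k \<and> t k \<le> a ^ m \<and> R \<le> 2 ^ k \<and> real R * real R * \<rho> ^ m \<le> 1" if "adm k" for k
  proof -
    have k: "k\<^sub>0 \<le> k" "(1 / 8) ^ k \<le> t k" using that by (auto simp: adm_def)
    have "(0 :: real) < (1 / 8) ^ k" by simp
    then show "0 < t k" using k by linarith
    show t4: "t k \<le> (1 / 4) ^ k" by (simp add: t_def)
    have "(1 / 4 :: real) ^ k < 1" using k by (simp add: power_less_one_iff k\<^sub>0_def)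
    then show "t k < 1" using t4 by simp
    show "\<exists>R m. \<rho> ^ R \<le> t k \<and> t k \<le> a ^ m \<and> R \<le> 2 ^ k \<and> real R * real R * \<rho> ^ m \<le> 1"
      using k t4 by (intro k') (auto simp: k\<^sub>0_def)
  qed
  have c_le: "c k \<le> wexp (4 * 2 ^ k) (\<lambda>b. of_bool (good k b))" for k
  proof (cases "adm k")
    case False
    then have "c k = 0" by (auto simp: c_def adm_def)
    then show ?thesis by (auto intro: wexp_nonneg)
  next
    case True
    let ?M = "2 ^ k :: nat"
    obtain R m where Rm: "\<rho> ^ R \<le> t k" "t k \<le> a ^ m" "R \<le> ?M" "real R * real R * \<rho> ^ m \<le> 1"
      using adm(4)[OF True] by blast
    have MMt: "real ?M * real ?M * t k = 4 ^ k * t k" by (simp flip: power_mult_distrib)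
    also have "\<dots> \<le> 4 ^ k * (1 / 4) ^ k" using adm(3)[OF True] by (intro mult_left_mono) auto
    also have "\<dots> = 1" by (simp flip: power_mult_distrib)
    finally have "real ?M * real ?M * t k \<le> 1" .
    then have "C * (real ?M * real ?M * t k)
      \<le> wexp (2 * ?M) (\<lambda>x. wexp (2 * ?M) (\<lambda>y. of_bool (\<exists>l<?M. \<exists>n<?M. hit (t k) x y l n)))"
      using hit_prob_ge[OF adm(1,2)[OF True] Rm(1,2,3)[unfolded \<rho>_def a_def]] Rm(4)
      by (simp add: C_def \<rho>_def a_def)
    also have "\<dots> = wexp (2 * ?M) (\<lambda>x. wexp (2 * ?M) (\<lambda>y. of_bool (good k (x @ y))))"
      using True by (intro wexp_cong) (simp add: good_def)
    also have "\<dots> = wexp (2 * ?M + 2 * ?M) (\<lambda>b. of_bool (good k b))" by (rule wexp_append[symmetric])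
    finally have "C * (4 ^ k * t k) \<le> wexp (2 * ?M + 2 * ?M) (\<lambda>b. of_bool (good k b))"
      unfolding MMt .
    then show ?thesis using True by (simp add: c_def adm_def)
  qed
  have "\<not> summable c"
    unfolding c_def
  proof (rule not_summable_truncated[where G = G and m = 3])
    show "\<not> summable (\<lambda>n. real (Suc n) * G (Suc n))"
      using not_summable_of_volume_series[OF g inf] by (simp add: G_def s_def)
  qed (auto simp: t_def G_mono \<open>0 < C\<close>, simp add: G_def)
  moreover have "0 \<le> c k" for k using \<open>0 < C\<close> adm(1)[of k] by (auto simp: c_def adm_def)
  ultimately have "AE \<omega> in bern. \<forall>K. \<exists>k\<ge>K. good k (stake (4 * 2 ^ k) (sdrop (4 * 2 ^ k) \<omega>))"
    using AE_infinitely_many_good_blocks[OF c_le] by blast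
  then have "AE \<omega> in bern. \<pi> \<omega> \<in> well_approx_set P q g"
    using AE_irrational
  proof eventually_elim
    fix \<omega> assume blocks: "\<forall>K. \<exists>k\<ge>K. good k (stake (4 * 2 ^ k) (sdrop (4 * 2 ^ k) \<omega>))"
      and irr: "\<pi> \<omega> \<notin> rational_points"
    show "\<pi> \<omega> \<in> well_approx_set P q g"
    proof (rule well_approxI[OF irr])
      fix N\<^sub>0
      obtain k where k: "N\<^sub>0 \<le> k" "good k (stake (4 * 2 ^ k) (sdrop (4 * 2 ^ k) \<omega>))"
        using blocks by blast
      define M where "M = (2 ^ k :: nat)"
      have "k < M" unfolding M_def by (rule less_exp)
      define x where "x = stake (2 * M) (sdrop (4 * M) \<omega>)"
      define y where "y = stake (2 * M) (sdrop (6 * M) \<omega>)"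
      have "take (2 * M) (stake (4 * M) (sdrop (4 * M) \<omega>)) = x"
        "drop (2 * M) (stake (4 * M) (sdrop (4 * M) \<omega>)) = y"
        by (simp_all add: x_def y_def take_stake drop_stake)
      then obtain l n where adm_k: "adm k" and ln: "l < M" "n < M" "hit (t k) x y l n"
        using k(2) unfolding good_def M_def[symmetric] by auto
      obtain R m where R: "\<rho> ^ R \<le> t k" "R \<le> M" using adm(4)[OF adm_k] by (auto simp: M_def)
      define u where "u = stopped (t k) (drop l x)"
      \<comment> \<open>Positions in the two halves become positions in \<open>\<omega>\<close>. The
        first half ends at \<open>6 * M\<close>, so the copy of \<open>u\<close> at
        \<open>l'\<close> ends no later than \<open>N\<close>.\<close>
      define l' where "l' = 4 * M + l"
      define N where "N = 6 * M + n"
      have dx: "drop l x = stake (2 * M - l) (sdrop l' \<omega>)"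
        by (simp add: x_def l'_def drop_stake)
      have dy: "drop n y = stake (2 * M - n) (sdrop N \<omega>)"
        by (simp add: y_def N_def drop_stake)
      have ux: "u = stake (length u) (sdrop l' \<omega>)" "length u \<le> 2 * M - l"
        using prefix_stake[of u "2 * M - l"] prefix_stopped[of "t k" "drop l x"] dx by (simp_all add: u_def)
      have uy: "u = stake (length u) (sdrop N \<omega>)"
        using prefix_stake(1)[of u "2 * M - n"] ln(3) dy by (simp add: u_def hit_def)
      have lN: "l' < N" "l' + length u \<le> N" using ux(2) ln by (auto simp: l'_def N_def)
      have "dist (\<pi> \<omega>) (code_pt (stake N \<omega>) l')
          \<le> rw (stake N \<omega>) * rw (stake (length u) (sdrop N \<omega>)) * D"
        using lN ux(1) uy by (intro dist_code_pt) auto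
      then have dist: "dist (\<pi> \<omega>) (code_pt (stake N \<omega>) l') \<le> rw (stake N \<omega>) * rw u * D"
        using uy by simp
      have "wt u \<le> t k"
        unfolding u_def using adm(1,2)[OF adm_k] R ln(1)
        by (intro wt_stopped_le[where R = R]) (auto simp: \<rho>_def x_def)
      also have "\<dots> \<le> G (2 ^ (k + 3)) / 2" by (simp add: t_def)
      finally have "rw u powr s \<le> G (2 ^ (k + 3)) / 2" by (simp add: wt_eq_rw_powr s_def)
      moreover have "0 < rw u powr s" using rw_pos[of u] by simp
      ultimately have "rw u powr s < G (2 ^ (k + 3))" by linarith
      then have "rw u < g (2 ^ (k + 3))"
        using powr_mono2[of s "g (2 ^ (k + 3))" "rw u"] s g[of "2 ^ (k + 3)"]
        by (force simp: G_def not_le[symmetric])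
      also have "\<dots> \<le> g N"
        using ln \<open>k < M\<close> by (intro g_mono) (auto simp: N_def M_def power_add)
      finally have "rw (stake N \<omega>) * rw u * D < rw (stake N \<omega>) * g N * D"
        using rw_pos D_pos by simp
      then have "dist (\<pi> \<omega>) (code_pt (stake N \<omega>) l') < radius g (stake N \<omega>)"
        using dist by (simp add: radius_eq mult_ac)
      moreover have "rw (stake N \<omega>) * rw u * D \<le> (1 / 2) ^ N * 1 * D"
      proof (intro mult_right_mono mult_mono)
        show "rw (stake N \<omega>) \<le> (1 / 2) ^ N" using rw_le[of "stake N \<omega>"] by simp
        have "(1 / 2 :: real) ^ length u \<le> 1" by (intro power_le_one) auto
        then show "rw u \<le> 1" using rw_le[of u] by linarith
      qed (use rw_pos[of u] D_pos in auto)
      then have "dist (\<pi> \<omega>) (code_pt (stake N \<omega>) l') \<le> (1 / 2) ^ N * D" using dist by simp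
      moreover have "N\<^sub>0 \<le> N" using k(1) \<open>k < M\<close> by (simp add: N_def)
      ultimately show "\<exists>N l. N\<^sub>0 \<le> N \<and> l < N
        \<and> dist (\<pi> \<omega>) (code_pt (stake N \<omega>) l) < radius g (stake N \<omega>)
        \<and> dist (\<pi> \<omega>) (code_pt (stake N \<omega>) l) \<le> (1 / 2) ^ N * D"
        using lN(1) by blast
    qed
  qed
  moreover have "{\<omega> \<in> space bern. \<pi> \<omega> \<in> well_approx_set P q g} \<in> events"
    using well_approx_set_borel[of g] by measurable
  ultimately have "emeasure bern {\<omega> \<in> space bern. \<pi> \<omega> \<in> well_approx_set P q g} = 1"
    by (intro emeasure_eq_1_AE) auto
  then show ?thesis
    unfolding self_similar_measure_def bern_eq
    using well_approx_set_borel[of g] by (simp add: emeasure_distr vimage_def)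
qed

end

theorem theorem2p5:
  fixes P :: "'a::finite \<Rightarrow> int ^ 'd::finite"
    and q :: "'a \<Rightarrow> int"
    and g :: "nat \<Rightarrow> real"
  assumes "\<And>a. \<bar>q a\<bar> \<ge> 2"
    and "\<And>n. n \<ge> 1 \<Longrightarrow> g n \<ge> 0"
  shows "(\<forall>s\<ge>0. volume_series P q g s < \<infinity> \<longrightarrow> hausdorff_measure s (well_approx_set P q g) = 0) \<and>
    (antimono_on {1..} g \<and>
     weight_entropy q < - 2 * ln (\<Sum>a\<in>UNIV. (prob_weight q a)\<^sup>2) \<and>
     volume_series P q g (sim_dim q) = \<infinity> \<longrightarrow>
     emeasure (self_similar_measure P q) (well_approx_set P q g) = 1)"
proof -
  interpret integer_ifs P q by unfold_locales (rule assms(1))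
  \<comment> \<open>If the attractor is a point, all cylinder diameters vanish, and
    \<open>0 powr s = 0\<close> makes the series zero rather than infinite.\<close>
  have "0 < D" if "volume_series P q g (sim_dim q) = \<infinity>"
  proof (rule ccontr)
    assume "\<not> 0 < D"
    then have "D = 0" using D_nonneg by simp
    then have "volume_series P q g (sim_dim q) = 0"
      by (simp add: volume_series_def diameter_cylinder)
    then show False using that by simp
  qed
  then have "emeasure (self_similar_measure P q) (well_approx_set P q g) = 1"
    if "antimono_on {1..} g" "volume_series P q g (sim_dim q) = \<infinity>"
    using that assms(2)
    by (intro nontrivial_ifs.emeasure_well_approx nontrivial_ifs.intro integer_ifs_axioms
        nontrivial_ifs_axioms.intro) auto
  then show ?thesis using hausdorff_measure_well_approx_zero assms(2) by blast
qed

end
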